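(* Let $\ell:\mathbb{N}\to\mathbb{N}$ satisfy $\ell(m)=o\!\left(\frac{m}{\log m}\right)$. Then, for any $\ell$-index-based improvement rule $\Pi^P$, there is a family $(\mathcal{G}_m)_{m\in\mathbb{N}}$ of sink parity games, where $\mathcal{G}_m$ has $m$ player 0 edges, such that strategy improvement with improvement rule $\Pi^P$ requires $m^{\omega(1)}$ (i.e. superpolynomially many in $m$) iterations to find the optimal strategy.
   Context: A sink parity game is a tuple $(V_0,V_1,E,\pi)$ specifying a directed graph on $V_G=V_0\cup V_1\cup\{\top\}$ (disjoint union) in which every vertex has an outgoing edge, the sink $\top$ has only the self-loop $(\top,\top)$ as outgoing edge, and $\pi:V_G\to\mathbb{Z}\cup\{-\infty\}$ is a priority function with $\pi(\top)=-\infty$ and $\pi(v)\in\mathbb{Z}$ for $v\ne\top$. Player $i$ owns $V_i$; player 0 edges are the edges leaving $V_0$. A player-$i$ strategy is a map $\sigma:V_i\to V_G$ with $(v,\sigma(v))\in E$; let $E_{\sigma}$ consist of the edges $(v,\sigma(v))$, $v\in V_i$, together with all edges leaving vertices not in $V_i$. A player 0 strategy $\sigma$ is admissible if every cycle of $E_\sigma$ not containing $\top$ has even highest priority; it is assumed that the game has an admissible player 0 strategy and a player 1 strategy all of whose cycles (not containing $\top$) have odd highest priority. For finite multisets $S_1,S_2$ of integers, $S_1\triangleleft S_2$ means $\sum_{s\in S_1}(-|V_0\cup V_1|)^s<\sum_{s\in S_2}(-|V_0\cup V_1|)^s$ (counted with multiplicity). For an admissible $\sigma$, let $\bar\sigma$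 be an optimal counterstrategy of player 1 (minimizing the following valuations for all start vertices simultaneously); from each $v_0$ the play under $\sigma,\bar\sigma$ is a simple path $v_0,\dots,v_k,\top$, and $\mathrm{val}_\sigma(v_0)$ is the multiset $\{\pi(v_0),\dots,\pi(v_k)\}$. A player 0 edge $(v,w)$ is an improving switch for $\sigma$ if $\mathrm{val}_\sigma(w)\triangleright\mathrm{val}_\sigma(\sigma(v))$; applying it yields the strategy that agrees with $\sigma$ except that $v\mapsto w$. A strategy is optimal iff it has no improving switch. Strategy improvement starts at an admissible strategy and in each iteration applies one improving switch, chosen by an improvement rule, until an optimal strategy is reached. Each player 0 edge carries a distinct positive integer, its Bland number. Given $\ell:\mathbb{N}\to\mathbb{N}$, an $\ell$-index-selector function is $P:\mathbb{N}^3\to\mathbb{N}^2$ with $P(p,m,h)\in\{1,\dots,p\}\times\{1,\dots,\ell(m)\}$. The induced $\ell$-index-based improvement rule $\Pi^P$ starts in memory state $1$; in a game with $m$ player 0 edges, at a strategy with $p\ge1$ improving switches and memory state $h$, if $P(p,m,h)=(i',h')$ it applies the improving switch with the $i'$-th smallest Bland number among the improving switches and moves to memory state $h'$. *)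

theory Defs
  imports Main "HOL-Library.Multiset" "HOL-Library.Landau_Symbols"
begin

text \<open>Sink parity games on vertex type nat. The priority of the sink (minus infinity)
is never used: valuations only contain priorities of non-sink vertices.\<close>

record spg =
  V0 :: "nat set"
  V1 :: "nat set"
  sink :: nat
  E :: "(nat \<times> nat) set"
  pri :: "nat \<Rightarrow> int"

definition VG :: "spg \<Rightarrow> nat set" where
  "VG G = V0 G \<union> V1 G \<union> {sink G}"

definition p0_edges :: "spg \<Rightarrow> (nat \<times> nat) set" where
  "p0_edges G = {(v, w). (v, w) \<in> E G \<and> v \<in> V0 G}"

definition strategy0 :: "spg \<Rightarrow> (nat \<Rightarrow> nat) \<Rightarrow> bool" where
  "strategy0 G \<sigma> \<longleftrightarrow> (\<forall>v \<in> V0 G. (v, \<sigma> v) \<in> E G)"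

definition strategy1 :: "spg \<Rightarrow> (nat \<Rightarrow> nat) \<Rightarrow> bool" where
  "strategy1 G \<tau> \<longleftrightarrow> (\<forall>v \<in> V1 G. (v, \<tau> v) \<in> E G)"

definition strat_edges :: "spg \<Rightarrow> nat set \<Rightarrow> (nat \<Rightarrow> nat) \<Rightarrow> (nat \<times> nat) set" where
  "strat_edges G Vi \<sigma> = {(v, \<sigma> v) | v. v \<in> Vi} \<union> {(v, w). (v, w) \<in> E G \<and> v \<notin> Vi}"

definition is_cycle :: "(nat \<times> nat) set \<Rightarrow> nat list \<Rightarrow> bool" where
  "is_cycle R cs \<longleftrightarrow> cs \<noteq> [] \<and> distinct cs \<and>
     (\<forall>i. Suc i < length cs \<longrightarrow> (cs ! i, cs ! Suc i) \<in> R) \<and> (last cs, hd cs) \<in> R"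

definition max_pri :: "spg \<Rightarrow> nat list \<Rightarrow> int" where
  "max_pri G cs = Max (pri G ` set cs)"

definition admissible :: "spg \<Rightarrow> (nat \<Rightarrow> nat) \<Rightarrow> bool" where
  "admissible G \<sigma> \<longleftrightarrow> strategy0 G \<sigma> \<and>
     (\<forall>cs. is_cycle (strat_edges G (V0 G) \<sigma>) cs \<and> sink G \<notin> set cs \<longrightarrow> even (max_pri G cs))"

definition p1_odd :: "spg \<Rightarrow> (nat \<Rightarrow> nat) \<Rightarrow> bool" where
  "p1_odd G \<tau> \<longleftrightarrow> strategy1 G \<tau> \<and>
     (\<forall>cs. is_cycle (strat_edges G (V1 G) \<tau>) cs \<and> sink G \<notin> set cs \<longrightarrow> odd (max_pri G cs))"

definition sink_parity_game :: "spg \<Rightarrow> bool" where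
  "sink_parity_game G \<longleftrightarrow>
     finite (V0 G) \<and> finite (V1 G) \<and> V0 G \<inter> V1 G = {} \<and> sink G \<notin> V0 G \<union> V1 G \<and>
     E G \<subseteq> VG G \<times> VG G \<and> (\<forall>v \<in> VG G. \<exists>w. (v, w) \<in> E G) \<and>
     {w. (sink G, w) \<in> E G} = {sink G} \<and>
     (\<exists>\<sigma>. admissible G \<sigma>) \<and> (\<exists>\<tau>. p1_odd G \<tau>)"

definition succ :: "spg \<Rightarrow> (nat \<Rightarrow> nat) \<Rightarrow> (nat \<Rightarrow> nat) \<Rightarrow> nat \<Rightarrow> nat" where
  "succ G \<sigma> \<tau> v = (if v \<in> V0 G then \<sigma> v else if v \<in> V1 G then \<tau> v else sink G)"

definition reaches_sink :: "spg \<Rightarrow> (nat \<Rightarrow> nat) \<Rightarrow> (nat \<Rightarrow> nat) \<Rightarrow> nat \<Rightarrow> bool" where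
  "reaches_sink G \<sigma> \<tau> v \<longleftrightarrow> (\<exists>k. (succ G \<sigma> \<tau> ^^ k) v = sink G)"

definition play_val :: "spg \<Rightarrow> (nat \<Rightarrow> nat) \<Rightarrow> (nat \<Rightarrow> nat) \<Rightarrow> nat \<Rightarrow> int multiset" where
  "play_val G \<sigma> \<tau> v =
     mset (map (\<lambda>i. pri G ((succ G \<sigma> \<tau> ^^ i) v))
       [0..<(LEAST k. (succ G \<sigma> \<tau> ^^ k) v = sink G)])"

definition weight :: "spg \<Rightarrow> int multiset \<Rightarrow> real" where
  "weight G S = (\<Sum>s\<in>#S. (- real (card (V0 G \<union> V1 G))) powi s)"

definition val_less :: "spg \<Rightarrow> int multiset \<Rightarrow> int multiset \<Rightarrow> bool" where
  "val_less G S1 S2 \<longleftrightarrow> weight G S1 < weight G S2"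

definition optimal_counter :: "spg \<Rightarrow> (nat \<Rightarrow> nat) \<Rightarrow> (nat \<Rightarrow> nat) \<Rightarrow> bool" where
  "optimal_counter G \<sigma> \<tau> \<longleftrightarrow> strategy1 G \<tau> \<and>
     (\<forall>v \<in> VG G. reaches_sink G \<sigma> \<tau> v \<and>
        (\<forall>\<tau>'. strategy1 G \<tau>' \<and> reaches_sink G \<sigma> \<tau>' v \<longrightarrow>
            \<not> val_less G (play_val G \<sigma> \<tau>' v) (play_val G \<sigma> \<tau> v)))"

definition val :: "spg \<Rightarrow> (nat \<Rightarrow> nat) \<Rightarrow> nat \<Rightarrow> int multiset" where
  "val G \<sigma> v = play_val G \<sigma> (SOME \<tau>. optimal_counter G \<sigma> \<tau>) v"

definition improving :: "spg \<Rightarrow> (nat \<Rightarrow> nat) \<Rightarrow> (nat \<times> nat) \<Rightarrow> bool" where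
  "improving G \<sigma> e \<longleftrightarrow> e \<in> p0_edges G \<and> val_less G (val G \<sigma> (\<sigma> (fst e))) (val G \<sigma> (snd e))"

definition improving_switches :: "spg \<Rightarrow> (nat \<Rightarrow> nat) \<Rightarrow> (nat \<times> nat) set" where
  "improving_switches G \<sigma> = {e. improving G \<sigma> e}"

definition optimal :: "spg \<Rightarrow> (nat \<Rightarrow> nat) \<Rightarrow> bool" where
  "optimal G \<sigma> \<longleftrightarrow> improving_switches G \<sigma> = {}"

definition apply_switch :: "(nat \<Rightarrow> nat) \<Rightarrow> (nat \<times> nat) \<Rightarrow> (nat \<Rightarrow> nat)" where
  "apply_switch \<sigma> e = \<sigma>(fst e := snd e)"

definition bland_numbering :: "spg \<Rightarrow> (nat \<times> nat \<Rightarrow> nat) \<Rightarrow> bool" where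
  "bland_numbering G bl \<longleftrightarrow> inj_on bl (p0_edges G) \<and> (\<forall>e \<in> p0_edges G. bl e > 0)"

definition num_p0_edges :: "spg \<Rightarrow> nat" where
  "num_p0_edges G = card (p0_edges G)"

definition index_selector :: "(nat \<Rightarrow> nat) \<Rightarrow> (nat \<Rightarrow> nat \<Rightarrow> nat \<Rightarrow> nat \<times> nat) \<Rightarrow> bool" where
  "index_selector l P \<longleftrightarrow>
     (\<forall>p m h. p \<ge> 1 \<longrightarrow> P p m h \<in> {1..p} \<times> {1..l m})"

definition ith_smallest :: "(nat \<times> nat \<Rightarrow> nat) \<Rightarrow> (nat \<times> nat) set \<Rightarrow> nat \<Rightarrow> nat \<times> nat" where
  "ith_smallest bl I i = (THE e. e \<in> I \<and> card {e' \<in> I. bl e' < bl e} = i - 1)"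

text \<open>One iteration of strategy improvement with rule Pi^P; state = (strategy, memory).\<close>
definition rule_step :: "spg \<Rightarrow> (nat \<times> nat \<Rightarrow> nat) \<Rightarrow> (nat \<Rightarrow> nat \<Rightarrow> nat \<Rightarrow> nat \<times> nat)
      \<Rightarrow> (nat \<Rightarrow> nat) \<times> nat \<Rightarrow> (nat \<Rightarrow> nat) \<times> nat" where
  "rule_step G bl P st =
     (let \<sigma> = fst st; h = snd st; I = improving_switches G \<sigma> in
      if I = {} then st
      else (let ih = P (card I) (num_p0_edges G) h
            in (apply_switch \<sigma> (ith_smallest bl I (fst ih)), snd ih)))"

definition run :: "spg \<Rightarrow> (nat \<times> nat \<Rightarrow> nat) \<Rightarrow> (nat \<Rightarrow> nat \<Rightarrow> nat \<Rightarrow> nat \<times> nat)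
      \<Rightarrow> (nat \<Rightarrow> nat) \<Rightarrow> nat \<Rightarrow> (nat \<Rightarrow> nat) \<times> nat" where
  "run G bl P \<sigma>0 k = (rule_step G bl P ^^ k) (\<sigma>0, 1)"

end

theory Submission
  imports Defs "HOL-Library.Countable"
begin

text \<open>
  The games are acyclic, so every play reaches the sink. Each level of the counter
  has two player 0 vertices, both pointing to one of the two vertices of the level below. When the
  worse vertex of a level is switched it overtakes the better one, which makes both vertices of the
  next level improvable again; switching the topmost level first therefore doubles the number of
  switches per level, giving at least \<open>2^b\<close> switches for \<open>b\<close> levels.

  To force an arbitrary rule to follow this order, watcher vertices, never switched, keep the number
  \<open>p\<close> of improving switches constant: each of them is improving exactly when a counter edge is not.
  With \<open>p\<close> fixed the rule is an autonomous automaton with at most \<open>l(m)\<close> states, hence eventually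
  periodic. The counter is advanced only in one memory state of the period, whose index is followed
  by a gap large enough to hold all counter edges and watchers; such a gap exists by pigeonhole as
  soon as \<open>p\<close> exceeds \<open>l(m)\<close> times the number of counter edges (up to reversing the Bland
  numbers). In the other memory states the rule switches domino vertices: every level has a chain of
  them, triggered by a switch at that level, exactly one of which is improving at a time and whose
  Bland number is chosen so that it has the index the rule asks for. Dominoes at level 0 absorb the
  preperiod. This takes \<open>O(b l(m))\<close> edges, which leaves room for \<open>b\<close> growing faster than
  \<open>log m\<close>.
\<close>

section \<open>Sink parity games on acyclic graphs\<close>

locale sink_dag =
  fixes G :: spg and rank_of :: "nat \<Rightarrow> nat"
  assumes fin: "finite (V0 G)" "finite (V1 G)"
    and disj: "V0 G \<inter> V1 G = {}"
    and snk: "sink G \<notin> V0 G \<union> V1 G"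
    and closed: "E G \<subseteq> VG G \<times> VG G"
    and total: "\<And>v. v \<in> VG G \<Longrightarrow> \<exists>w. (v, w) \<in> E G"
    and loop: "{w. (sink G, w) \<in> E G} = {sink G}"
    and dec: "\<And>v w. (v, w) \<in> E G \<Longrightarrow> v \<noteq> sink G \<Longrightarrow> rank_of w < rank_of v"
begin

text \<open>On a cycle avoiding the sink, a vertex of least rank would have a successor of smaller
  rank. Hence the parity conditions in \<open>admissible\<close> and \<open>p1_odd\<close> hold
  vacuously for every strategy.\<close>

lemma no_cycle:
  assumes cs: "is_cycle R cs" and R: "R \<subseteq> E G" and s: "sink G \<notin> set cs"
  shows False
proof -
  have ne: "cs \<noteq> []" using cs by (simp add: is_cycle_def)
  define x where "x = arg_min_on rank_of (set cs)"
  have x: "x \<in> set cs" and xm: "\<And>y. y \<in> set cs \<Longrightarrow> rank_of x \<le> rank_of y"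
    unfolding x_def using ne arg_min_if_finite[of "set cs" rank_of] by (auto simp: not_less[symmetric])
  obtain i where i: "i < length cs" "cs ! i = x" using x by (auto simp: in_set_conv_nth)
  have "\<exists>y \<in> set cs. (x, y) \<in> R"
  proof (cases "Suc i < length cs")
    case True
    then show ?thesis using cs i by (metis is_cycle_def nth_mem)
  next
    case False
    then have "last cs = x" using i ne by (metis last_conv_nth Suc_lessI diff_Suc_1)
    then show ?thesis using cs ne by (metis is_cycle_def hd_in_set)
  qed
  then obtain y where "y \<in> set cs" "(x, y) \<in> E G" using R by auto
  then have "rank_of y < rank_of x" using dec x s by metis
  then show False using xm[OF \<open>y \<in> set cs\<close>] by simp
qed

lemma admissibleI: "strategy0 G \<sigma> \<Longrightarrow> admissible G \<sigma>"
proof -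
  assume s: "strategy0 G \<sigma>"
  then have "strat_edges G (V0 G) \<sigma> \<subseteq> E G" by (auto simp: strat_edges_def strategy0_def)
  then show ?thesis using s no_cycle by (auto simp: admissible_def)
qed

lemma p1_oddI: "strategy1 G \<tau> \<Longrightarrow> p1_odd G \<tau>"
proof -
  assume s: "strategy1 G \<tau>"
  then have "strat_edges G (V1 G) \<tau> \<subseteq> E G" by (auto simp: strat_edges_def strategy1_def)
  then show ?thesis using s no_cycle by (auto simp: p1_odd_def)
qed

lemma game: "sink_parity_game G"
proof -
  obtain f where f: "\<And>v. v \<in> VG G \<Longrightarrow> (v, f v) \<in> E G" using total by metis
  then have "admissible G f" "p1_odd G f"
    by (auto intro!: admissibleI p1_oddI simp: strategy0_def strategy1_def VG_def)
  then show ?thesis unfolding sink_parity_game_def using fin disj snk closed total loop by metis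
qed

abbreviation wt :: "nat \<Rightarrow> real" where
  "wt v \<equiv> (- real (card (V0 G \<union> V1 G))) powi (pri G v)"

context
  fixes \<sigma> \<tau> assumes s0: "strategy0 G \<sigma>" and s1: "strategy1 G \<tau>"
begin

lemma succ_edge: "v \<in> VG G \<Longrightarrow> (v, succ G \<sigma> \<tau> v) \<in> E G"
  using s0 s1 loop unfolding VG_def succ_def strategy0_def strategy1_def by auto

lemma succ_VG: "v \<in> VG G \<Longrightarrow> succ G \<sigma> \<tau> v \<in> VG G"
  using succ_edge closed by blast

lemma reaches: "v \<in> VG G \<Longrightarrow> reaches_sink G \<sigma> \<tau> v"
proof (induction "rank_of v" arbitrary: v rule: less_induct)
  case less
  show ?case
  proof (cases "v = sink G")
    case True
    then show ?thesis unfolding reaches_sink_def by (intro exI[of _ 0]) simp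
  next
    case False
    then have "rank_of (succ G \<sigma> \<tau> v) < rank_of v" using dec succ_edge less by blast
    then obtain k where "(succ G \<sigma> \<tau> ^^ k) (succ G \<sigma> \<tau> v) = sink G"
      using less succ_VG unfolding reaches_sink_def by blast
    then show ?thesis unfolding reaches_sink_def
      by (intro exI[of _ "Suc k"]) (simp add: funpow_swap1)
  qed
qed

lemma weight_sink: "weight G (play_val G \<sigma> \<tau> (sink G)) = 0"
proof -
  have "(LEAST k. (succ G \<sigma> \<tau> ^^ k) (sink G) = sink G) = 0" by (rule Least_eq_0) simp
  then show ?thesis by (simp add: play_val_def weight_def)
qed

lemma weight_step:
  assumes v: "v \<in> VG G" "v \<noteq> sink G"
  shows "weight G (play_val G \<sigma> \<tau> v) = wt v + weight G (play_val G \<sigma> \<tau> (succ G \<sigma> \<tau> v))"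
proof -
  let ?f = "succ G \<sigma> \<tau>"
  obtain k where "(?f ^^ k) v = sink G" using reaches[OF v(1)] unfolding reaches_sink_def by auto
  then have "(LEAST k. (?f ^^ k) v = sink G) = Suc (LEAST k. (?f ^^ Suc k) v = sink G)"
    by (rule Least_Suc) (use v in auto)
  also have "(LEAST k. (?f ^^ Suc k) v = sink G) = (LEAST k. (?f ^^ k) (?f v) = sink G)"
    by (simp add: funpow_swap1)
  finally have L: "(LEAST k. (?f ^^ k) v = sink G) = Suc (LEAST k. (?f ^^ k) (?f v) = sink G)" .
  let ?L = "LEAST k. (?f ^^ k) (?f v) = sink G"
  have "map (\<lambda>i. pri G ((?f ^^ i) v)) [0..<Suc ?L] =
      pri G v # map (\<lambda>i. pri G ((?f ^^ i) (?f v))) [0..<?L]"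
    unfolding upt_conv_Cons[OF zero_less_Suc] map_Suc_upt[symmetric] by (simp add: funpow_swap1)
  then have "play_val G \<sigma> \<tau> v = add_mset (pri G v) (play_val G \<sigma> \<tau> (?f v))"
    unfolding play_val_def L by simp
  then show ?thesis by (simp add: weight_def)
qed

end

text \<open>Verification principle: \<open>x\<close> solves the Bellman equations, with \<sigma>
  fixed for player 0 and a minimum over edges for player 1. Induction on the rank shows that no
  counterstrategy gets below \<open>x\<close> and that a greedy one attains it. Only weights are
  compared by \<open>val_less\<close>, so the weight of \<open>val\<close> is all that has to be
  known.\<close>

lemma weight_val:
  assumes s0: "strategy0 G \<sigma>"
    and xs: "x (sink G) = 0"
    and x0: "\<And>v. v \<in> V0 G \<Longrightarrow> x v = wt v + x (\<sigma> v)"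
    and x1: "\<And>v w. v \<in> V1 G \<Longrightarrow> (v, w) \<in> E G \<Longrightarrow> x v \<le> wt v + x w"
    and x1': "\<And>v. v \<in> V1 G \<Longrightarrow> \<exists>w. (v, w) \<in> E G \<and> x v = wt v + x w"
    and v: "v \<in> VG G"
  shows "weight G (val G \<sigma> v) = x v"
proof -
  have lower: "x v \<le> weight G (play_val G \<sigma> \<tau> v)" if t: "strategy1 G \<tau>" and v: "v \<in> VG G" for \<tau> v
    using v
  proof (induction "rank_of v" arbitrary: v rule: less_induct)
    case less
    show ?case
    proof (cases "v = sink G")
      case True
      then show ?thesis using weight_sink[OF s0 t] xs by simp
    next
      case False
      have e: "(v, succ G \<sigma> \<tau> v) \<in> E G" using succ_edge[OF s0 t] less by simp
      then have "rank_of (succ G \<sigma> \<tau> v) < rank_of v" using dec False by blast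
      then have IH: "x (succ G \<sigma> \<tau> v) \<le> weight G (play_val G \<sigma> \<tau> (succ G \<sigma> \<tau> v))"
        using less succ_VG[OF s0 t] by blast
      have "x v \<le> wt v + x (succ G \<sigma> \<tau> v)"
      proof (cases "v \<in> V0 G")
        case True
        then show ?thesis using x0 by (simp add: succ_def)
      next
        case V: False
        then have "v \<in> V1 G" using less False by (auto simp: VG_def)
        then show ?thesis using x1 e by blast
      qed
      then show ?thesis using IH weight_step[OF s0 t less(2) False] by simp
    qed
  qed
  \<comment> \<open>The greedy counterstrategy always follows an edge that attains the
    minimum.\<close>
  define \<tau>s where "\<tau>s v = (SOME w. (v, w) \<in> E G \<and> x v = wt v + x w)" for v
  have ts: "(v, \<tau>s v) \<in> E G \<and> x v = wt v + x (\<tau>s v)" if "v \<in> V1 G" for v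
    unfolding \<tau>s_def by (rule someI_ex[OF x1'[OF that]])
  then have tss: "strategy1 G \<tau>s" by (simp add: strategy1_def)
  have eq: "weight G (play_val G \<sigma> \<tau>s v) = x v" if v: "v \<in> VG G" for v
    using v
  proof (induction "rank_of v" arbitrary: v rule: less_induct)
    case less
    show ?case
    proof (cases "v = sink G")
      case True
      then show ?thesis using weight_sink[OF s0 tss] xs by simp
    next
      case False
      have e: "(v, succ G \<sigma> \<tau>s v) \<in> E G" using succ_edge[OF s0 tss] less by simp
      then have "rank_of (succ G \<sigma> \<tau>s v) < rank_of v" using dec False by blast
      then have IH: "weight G (play_val G \<sigma> \<tau>s (succ G \<sigma> \<tau>s v)) = x (succ G \<sigma> \<tau>s v)"
        using less succ_VG[OF s0 tss] by blast
      have "x v = wt v + x (succ G \<sigma> \<tau>s v)"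
      proof (cases "v \<in> V0 G")
        case True
        then show ?thesis using x0 by (simp add: succ_def)
      next
        case V: False
        then have "v \<in> V1 G" using less False by (auto simp: VG_def)
        then show ?thesis using ts V by (simp add: succ_def)
      qed
      then show ?thesis using IH weight_step[OF s0 tss less(2) False] by simp
    qed
  qed
  \<comment> \<open>An optimal counterstrategy thus exists, so the \<open>SOME\<close> in
    \<open>val\<close> really denotes one, though possibly a different one of equal weight.\<close>
  have "optimal_counter G \<sigma> \<tau>s"
    unfolding optimal_counter_def val_less_def using tss reaches[OF s0 tss] eq lower
    by (auto simp: not_less)
  then have opt: "optimal_counter G \<sigma> (SOME \<tau>. optimal_counter G \<sigma> \<tau>)" by (rule someI[where P = "optimal_counter G \<sigma>"])
  let ?t = "SOME \<tau>. optimal_counter G \<sigma> \<tau>"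
  have "\<not> val_less G (play_val G \<sigma> \<tau>s v) (play_val G \<sigma> ?t v)"
    using opt v tss reaches[OF s0 tss v] unfolding optimal_counter_def by blast
  then have "weight G (play_val G \<sigma> ?t v) \<le> x v"
    using eq[OF v] by (simp add: val_less_def)
  moreover have "x v \<le> weight G (play_val G \<sigma> ?t v)"
    using lower opt v unfolding optimal_counter_def by blast
  ultimately show ?thesis unfolding val_def by simp
qed

end

section \<open>Selection by rank\<close>

lemma card_rank_less:
  fixes f :: "'a \<Rightarrow> nat"
  assumes "finite I" "e \<in> I"
  shows "card {e' \<in> I. f e' < f e} < card I"
  by (rule psubset_card_mono) (use assms in auto)

lemma inj_on_rank:
  fixes f :: "'a \<Rightarrow> nat"
  assumes "finite I" "inj_on f I"
  shows "inj_on (\<lambda>e. card {e' \<in> I. f e' < f e}) I"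
proof -
  have *: "card {e' \<in> I. f e' < f x} < card {e' \<in> I. f e' < f y}" if "x \<in> I" "f x < f y" for x y
    by (rule psubset_card_mono) (use assms that in auto)
  show ?thesis
  proof (rule inj_onI)
    fix x y assume "x \<in> I" "y \<in> I" "card {e' \<in> I. f e' < f x} = card {e' \<in> I. f e' < f y}"
    then have "f x = f y" using *[of x y] *[of y x] by (metis less_irrefl linorder_neqE_nat)
    then show "x = y" using assms \<open>x \<in> I\<close> \<open>y \<in> I\<close> by (auto dest: inj_onD)
  qed
qed

lemma ex_rank:
  fixes f :: "'a \<Rightarrow> nat"
  assumes I: "finite I" "inj_on f I" and r: "r < card I"
  shows "\<exists>e \<in> I. card {e' \<in> I. f e' < f e} = r"
proof -
  let ?r = "\<lambda>e. card {e' \<in> I. f e' < f e}"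
  have "?r ` I = {..<card I}"
  proof (rule card_subset_eq)
    show "?r ` I \<subseteq> {..<card I}" using card_rank_less[OF I(1)] by auto
    show "card (?r ` I) = card {..<card I}" using card_image[OF inj_on_rank[OF I]] by simp
  qed simp
  then have "r \<in> ?r ` I" using r by blast
  then show ?thesis by blast
qed

text \<open>Used to place a Bland number with a prescribed number of competitors below it. For
  \<open>r = card I\<close> no element has that rank, and a bound above all values of
  \<open>f\<close> serves.\<close>

lemma ex_threshold:
  fixes f :: "'a \<Rightarrow> nat"
  assumes I: "finite I" "inj_on f I" and r: "r \<le> card I"
  shows "\<exists>\<theta>. card {e \<in> I. f e < \<theta>} = r"
proof (cases "r < card I")
  case True
  then show ?thesis using ex_rank[OF I] by metis
next
  case False
  have "{e \<in> I. f e < Suc (sum f I)} = I" using I member_le_sum[of _ I f] by (auto simp: less_Suc_eq_le)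
  then show ?thesis using False r by (metis le_antisym not_less)
qed

lemma ith_smallestI:
  assumes "finite I" "inj_on bl I" "e \<in> I" "card {e' \<in> I. bl e' < bl e} = i - 1"
  shows "ith_smallest bl I i = e"
  unfolding ith_smallest_def
  by (rule the_equality) (use assms inj_onD[OF inj_on_rank[OF assms(1,2)]] in auto)

text \<open>Every other element of \<open>I\<close> lies either below or above the selected one, so
  the ranks of that element in the two orders add up to \<open>card I - 1\<close>.\<close>

lemma ith_smallest_mirror:
  assumes I: "finite I" "inj_on bl I" and B: "\<And>e. e \<in> I \<Longrightarrow> bl e < B"
    and i: "1 \<le> i" "i \<le> card I"
  shows "ith_smallest (\<lambda>e. B - bl e) I (card I + 1 - i) = ith_smallest bl I i"
proof -
  have "i - 1 < card I" using i by linarith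
  then obtain e where e: "e \<in> I" "card {e' \<in> I. bl e' < bl e} = i - 1"
    using ex_rank[OF I] by blast
  have inj: "inj_on (\<lambda>e. B - bl e) I"
  proof (rule inj_onI)
    fix x y assume xy: "x \<in> I" "y \<in> I" "B - bl x = B - bl y"
    then have "bl x = bl y" using B[of x] B[of y] by linarith
    then show "x = y" using inj_onD[OF I(2)] xy by blast
  qed
  have "e' = e \<or> bl e' < bl e \<or> B - bl e' < B - bl e" if "e' \<in> I" for e'
    using inj_onD[OF I(2) _ that e(1)] B[OF that] B[OF e(1)] by linarith
  then have "I = {e' \<in> I. bl e' < bl e} \<union> insert e {e' \<in> I. B - bl e' < B - bl e}"
    using e(1) by blast
  then have "card I = card ({e' \<in> I. bl e' < bl e} \<union> insert e {e' \<in> I. B - bl e' < B - bl e})" by simp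
  also have "\<dots> = card {e' \<in> I. bl e' < bl e} + card (insert e {e' \<in> I. B - bl e' < B - bl e})"
    by (rule card_Un_disjoint) (use I in auto)
  also have "card (insert e {e' \<in> I. B - bl e' < B - bl e}) = Suc (card {e' \<in> I. B - bl e' < B - bl e})"
    using I by simp
  finally have "card {e' \<in> I. B - bl e' < B - bl e} = card I + 1 - i - 1" using e i by simp
  then have "ith_smallest (\<lambda>e. B - bl e) I (card I + 1 - i) = e"
    using ith_smallestI[OF I(1) inj e(1)] by blast
  then show ?thesis using ith_smallestI[OF I e] by simp
qed

section \<open>The counter game\<close>

text \<open>\<open>Level\<close> vertices form the counter; \<open>Signal\<close>,
  \<open>Pad\<close> and \<open>Domino\<close> form the chain attached to each level;
  \<open>Watch\<close> and \<open>Tail\<close> are the watchers of level vertices and of chains.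
  Dummies are improving all the time; a \<open>Filler\<close> has a single edge and only adjusts the
  number of edges.\<close>

datatype node = Sink | Level nat bool | Signal nat nat bool | Pad nat nat bool | Domino nat nat
  | Watch nat bool bool | Tail nat bool | Dummy nat | Filler nat

instance node :: countable
  by countable_datatype

abbreviation code :: "node \<Rightarrow> nat" where
  "code \<equiv> to_nat"

text \<open>The levels are \<open>0..b\<close>, \<open>nD\<close> and \<open>nF\<close> count
  dummies and fillers, and \<open>R k\<close> is the length of the domino chain at level
  \<open>k\<close>.\<close>

locale counter =
  fixes b nD nF :: nat and R :: "nat \<Rightarrow> nat"
  assumes R_pos: "0 < R k"
begin

fun own0 :: "node \<Rightarrow> bool" where
  "own0 (Level k j) \<longleftrightarrow> 1 \<le> k \<and> k \<le> b"
| "own0 (Domino k g) \<longleftrightarrow> k \<le> b \<and> g < R k"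
| "own0 (Watch k j i) \<longleftrightarrow> 1 \<le> k \<and> k \<le> b"
| "own0 (Tail k j) \<longleftrightarrow> k \<le> b"
| "own0 (Dummy d) \<longleftrightarrow> d < nD"
| "own0 (Filler d) \<longleftrightarrow> d < nF"
| "own0 _ \<longleftrightarrow> False"

fun own1 :: "node \<Rightarrow> bool" where
  "own1 (Level k j) \<longleftrightarrow> k = 0"
| "own1 (Signal k g j) \<longleftrightarrow> k \<le> b \<and> g < R k"
| "own1 (Pad k g j) \<longleftrightarrow> k \<le> b \<and> g < R k"
| "own1 _ \<longleftrightarrow> False"

text \<open>While \<open>Domino k g\<close> points to the worse of the two signals \<open>g\<close>, the detour through \<open>Pad\<close>
  makes both signals \<open>g + 1\<close> take the same value, so that the next domino is not yet improving.\<close>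

fun succs :: "node \<Rightarrow> node set" where
  "succs Sink = {Sink}"
| "succs (Level 0 j) = {Sink}"
| "succs (Level (Suc k) j) = {Level k False, Level k True}"
| "succs (Signal k 0 j) = {Level k j}"
| "succs (Signal k (Suc g) j) = {Pad k g j, Domino k g}"
| "succs (Pad k g j) = {Signal k g j}"
| "succs (Domino k g) = {Signal k g False, Signal k g True}"
| "succs (Watch k j i) = {Level (k - 1) i, Level k j}"
| "succs (Tail k j) = {Level k j, Domino k (R k - 1)}"
| "succs (Dummy d) = {Sink, Level 0 False}"
| "succs (Filler d) = {Sink}"

text \<open>All priorities are even, so all weights are positive. Lower levels carry larger
  priorities, so that a difference between the two vertices below outweighs the own weight of a
  level vertex.\<close>

fun prio :: "node \<Rightarrow> nat" where
  "prio (Level k j) = (if j then 2 * (b + 1 - k) else 0)"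
| "prio _ = 0"

fun height :: "node \<Rightarrow> nat" where
  "height Sink = 0"
| "height (Level k j) = k + 1"
| "height (Signal k g j) = b + 2 + 2 * g"
| "height (Pad k g j) = b + 3 + 2 * g"
| "height (Domino k g) = b + 3 + 2 * g"
| "height (Watch k j i) = b + 2"
| "height (Tail k j) = b + 4 + 2 * R k"
| "height (Dummy d) = 2"
| "height (Filler d) = 1"

definition nodes :: "node set" where
  "nodes = {v. own0 v \<or> own1 v \<or> v = Sink}"

definition G :: spg where
  "G = \<lparr>V0 = code ` {v. own0 v}, V1 = code ` {v. own1 v}, sink = code Sink,
     E = {(code v, code w) | v w. v \<in> nodes \<and> w \<in> succs v},
     pri = (\<lambda>n. int (prio (from_nat n)))\<rparr>"

lemma G_simps [simp]:
  "V0 G = code ` {v. own0 v}" "V1 G = code ` {v. own1 v}" "sink G = code Sink"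
  "pri G n = int (prio (from_nat n))"
  by (simp_all add: G_def)

lemma code_eq [simp]: "code v = code w \<longleftrightarrow> v = w"
  by (simp add: inj_eq)

lemma own_disj: "own0 v \<Longrightarrow> own1 v \<Longrightarrow> False"
  by (cases v) auto

lemma E_code [simp]: "(code v, code w) \<in> E G \<longleftrightarrow> v \<in> nodes \<and> w \<in> succs v"
  by (auto simp: G_def)

lemma in_E: "(x, y) \<in> E G \<longleftrightarrow> (\<exists>v w. x = code v \<and> y = code w \<and> v \<in> nodes \<and> w \<in> succs v)"
  by (auto simp: G_def)

lemma VG_eq: "VG G = code ` nodes"
  by (auto simp: VG_def nodes_def)

definition inner :: "node set" where
  "inner = (\<lambda>(k, j). Level k j) ` ({1..b} \<times> UNIV) \<union> (\<Union>k\<le>b. Domino k ` {..<R k})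
    \<union> (\<lambda>(k, j, i). Watch k j i) ` ({1..b} \<times> UNIV \<times> UNIV)
    \<union> (\<lambda>(k, j). Tail k j) ` ({..b} \<times> UNIV) \<union> Dummy ` {..<nD}"

lemma own0_eq: "{v. own0 v} = inner \<union> Filler ` {..<nF}" (is "?L = ?R")
proof (intro set_eqI)
  fix v show "v \<in> ?L \<longleftrightarrow> v \<in> ?R" unfolding inner_def by (cases v) (auto simp: image_iff)
qed

lemma finite_own0: "finite {v. own0 v}"
  unfolding own0_eq inner_def by auto

lemma finite_own1: "finite {v. own1 v}"
proof (rule finite_subset)
  show "{v. own1 v} \<subseteq> Level 0 ` UNIV \<union> (\<Union>k\<le>b. \<Union>g<R k. Signal k g ` UNIV \<union> Pad k g ` UNIV)"
  proof
    fix v assume "v \<in> {v. own1 v}"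
    then show "v \<in> Level 0 ` UNIV \<union> (\<Union>k\<le>b. \<Union>g<R k. Signal k g ` UNIV \<union> Pad k g ` UNIV)"
      by (cases v) force+
  qed
qed auto

lemma succs_nodes: "v \<in> nodes \<Longrightarrow> w \<in> succs v \<Longrightarrow> w \<in> nodes"
  using R_pos by (cases v rule: succs.cases) (auto simp: nodes_def)

lemma succs_height: "v \<in> nodes \<Longrightarrow> v \<noteq> Sink \<Longrightarrow> w \<in> succs v \<Longrightarrow> height w < height v"
  using R_pos by (cases v rule: succs.cases) (auto simp: nodes_def)

lemma succs_nonempty: "succs v \<noteq> {}"
  by (cases v rule: succs.cases) auto

sublocale sink_dag G "\<lambda>n. height (from_nat n)"
proof
  show "finite (V0 G)" "finite (V1 G)" using finite_own0 finite_own1 by auto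
  show "V0 G \<inter> V1 G = {}" using own_disj by auto
  show "sink G \<notin> V0 G \<union> V1 G" by auto
  show "E G \<subseteq> VG G \<times> VG G"
  proof
    fix e assume "e \<in> E G"
    then show "e \<in> VG G \<times> VG G" using succs_nodes by (cases e) (auto simp: in_E VG_eq)
  qed
  show "\<exists>w. (v, w) \<in> E G" if "v \<in> VG G" for v
    using that succs_nonempty by (fastforce simp: in_E VG_eq)
  show "{w. (sink G, w) \<in> E G} = {sink G}" by (auto simp: in_E nodes_def)
  show "height (from_nat w) < height (from_nat v)" if "(v, w) \<in> E G" "v \<noteq> sink G" for v w
    using that succs_height by (auto simp: in_E)
qed

lemma p0_edges_eq: "p0_edges G = {(code v, code w) | v w. own0 v \<and> w \<in> succs v}"
  by (auto simp: p0_edges_def in_E nodes_def)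

definition N :: nat where
  "N = card (V0 G \<union> V1 G)"

lemma N_ge: assumes "k \<le> b" shows "R k + 2 \<le> N"
proof -
  let ?S = "insert (code (Level 0 True)) (insert (code (Level 0 False)) ((\<lambda>g. code (Domino k g)) ` {..<R k}))"
  have "?S \<subseteq> V0 G \<union> V1 G" using assms by auto
  then have "card ?S \<le> N" unfolding N_def using fin by (intro card_mono) auto
  moreover have "card ((\<lambda>g. code (Domino k g)) ` {..<R k}) = R k"
    by (subst card_image) (auto simp: inj_on_def)
  then have "card ?S = R k + 2"
    by (simp add: card_insert_if image_iff)
  ultimately show ?thesis by simp
qed

definition U :: real where
  "U = (real N)\<^sup>2"

text \<open>The factor 4 leaves enough slack in the induction over levels. The second bound makes
  one step of priority outweigh all vertices of priority 0 along a whole chain.\<close>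

lemma U_ge: "4 \<le> U" "k \<le> b \<Longrightarrow> 2 * real (R k) + 1 \<le> U"
proof -
  have "2 \<le> real N" using N_ge[of 0] by simp
  then show "4 \<le> U" unfolding U_def power2_eq_square using mult_mono[of 2 "real N" 2 "real N"] by simp
  assume "k \<le> b"
  then have "real (R k) + 2 \<le> real N" using N_ge[of k] by linarith
  then have "(real (R k) + 2) * (real (R k) + 2) \<le> real N * real N" by (intro mult_mono) auto
  then show "2 * real (R k) + 1 \<le> U" 
    using zero_le_square[of "real (R k)"] unfolding U_def power2_eq_square distrib_left distrib_right
    by linarith
qed

section \<open>Valuations of the level vertices\<close>

definition level_weight :: "nat \<Rightarrow> bool \<Rightarrow> real" where
  "level_weight k j = (if j then U ^ (b + 1 - k) else 1)"

lemma wt_code: "wt (code v) = (case v of Level k j \<Rightarrow> level_weight k j | _ \<Rightarrow> 1)"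
proof -
  have "(- real N) powi int (2 * e) = U ^ e" for e
    by (simp only: power_int_of_nat power_mult U_def power2_minus)
  then have "(- real N) powi int (prio (Level k j)) = level_weight k j" for k j
    by (cases j) (simp_all add: level_weight_def)
  then show ?thesis unfolding N_def[symmetric] by (cases v) (simp_all del: G_simps(1,2))
qed

text \<open>\<open>Level k (dominant c k)\<close> is the better vertex of its level. If
  \<open>c k\<close> is 0 or 2, both vertices have the same successor and the larger own weight
  decides; if \<open>c k = 1\<close>, only \<open>Level k False\<close> points to the better
  successor.\<close>

definition dominant :: "(nat \<Rightarrow> nat) \<Rightarrow> nat \<Rightarrow> bool" where
  "dominant c k \<longleftrightarrow> k = 0 \<or> c k \<noteq> 1"

definition stale :: "(nat \<Rightarrow> nat) \<Rightarrow> nat \<Rightarrow> bool \<Rightarrow> bool" where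
  "stale c k j \<longleftrightarrow> (if j then c k \<noteq> 0 else c k = 2)"

definition level_ptr :: "(nat \<Rightarrow> nat) \<Rightarrow> nat \<Rightarrow> bool \<Rightarrow> bool" where
  "level_ptr c k j \<longleftrightarrow> dominant c (k - 1) \<noteq> stale c k j"

fun level_val :: "(nat \<Rightarrow> nat) \<Rightarrow> nat \<Rightarrow> bool \<Rightarrow> real" where
  "level_val c 0 j = level_weight 0 j"
| "level_val c (Suc k) j = level_weight (Suc k) j + level_val c k (level_ptr c (Suc k) j)"

text \<open>With a common successor, the two vertices differ by exactly their own weights. With
  different successors, the gap of the level below, at least \<open>4 * u - 1\<close>, beats the own
  weight \<open>u\<close> of the \<open>True\<close> vertex. The sign alone would not survive the
  induction, so the margin is carried along.\<close>

lemma level_val_margin: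
  assumes "k \<le> b" "\<And>k. c k \<le> 2"
  shows "U ^ (b + 1 - k) - 1 \<le> level_val c k (dominant c k) - level_val c k (\<not> dominant c k)"
  using assms(1)
proof (induction k)
  case 0
  then show ?case by (simp add: dominant_def level_weight_def)
next
  case (Suc k)
  define u where "u = U ^ (b + 1 - Suc k)"
  have e: "b + 1 - k = Suc (b + 1 - Suc k)" using Suc.prems by simp
  have "u \<ge> 1" unfolding u_def using U_ge by (intro one_le_power) simp
  moreover have "U ^ (b + 1 - k) = U * u" unfolding e u_def by simp
  moreover have "4 * u \<le> U * u" using U_ge \<open>u \<ge> 1\<close> by (intro mult_right_mono) auto
  ultimately have m: "u \<ge> 1" "4 * u - 1 \<le> level_val c k (dominant c k) - level_val c k (\<not> dominant c k)"
    using Suc.IH Suc.prems by linarith+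
  consider "c (Suc k) = 0" | "c (Suc k) = 1" | "c (Suc k) = 2" using assms(2)[of "Suc k"] by linarith
  moreover have "level_weight (Suc k) True = u" "level_weight (Suc k) False = 1" by (simp_all add: level_weight_def u_def)
  ultimately show ?case
    using m unfolding u_def[symmetric] level_val.simps dominant_def[of c "Suc k"]
    by cases (cases "dominant c k"; force simp: stale_def level_ptr_def)+
qed

lemma U_pow_ge: "k \<le> b \<Longrightarrow> U \<le> U ^ (b + 1 - k)"
  using power_increasing[of 1 "b + 1 - k" U] U_ge(1) by simp

lemma level_val_less:
  assumes "k \<le> b" "\<And>k. c k \<le> 2"
  shows "level_val c k (\<not> dominant c k) < level_val c k (dominant c k)"
  using level_val_margin[of k c, OF assms] U_pow_ge[OF assms(1)] U_ge(1) by linarith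

end

text \<open>In the state \<open>(c, \<kappa>, \<gamma>)\<close>, \<open>c k\<close> is the number of vertices of level \<open>k\<close> that point to the worse
  vertex of level \<open>k - 1\<close> (if only one does, it is \<open>Level k True\<close>). The level switched last is
  \<open>\<kappa>\<close>, and the first \<open>\<gamma>\<close> dominoes of its chain have followed; all other chains are up to date.
  Initially level 0 counts as just switched.\<close>

locale counter_state = counter +
  fixes c :: "nat \<Rightarrow> nat" and \<kappa> \<gamma> :: nat
  assumes c_le: "c k \<le> 2" and \<kappa>_le: "\<kappa> \<le> b" and \<gamma>_le: "\<gamma> \<le> R \<kappa>"
begin

definition progress :: "nat \<Rightarrow> nat" where
  "progress k = (if k = \<kappa> then \<gamma> else R k)"

text \<open>Dominoes that have followed point to the better signal, the lagging ones to the
  worse.\<close>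

definition domino_ptr :: "nat \<Rightarrow> nat \<Rightarrow> bool" where
  "domino_ptr k g \<longleftrightarrow> (dominant c k \<longleftrightarrow> g < progress k)"

fun sel :: "node \<Rightarrow> node" where
  "sel (Level k j) = Level (k - 1) (level_ptr c k j)"
| "sel (Domino k g) = Signal k g (domino_ptr k g)"
| "sel (Watch k j i) = Level (k - 1) i"
| "sel (Tail k j) = Level k j"
| "sel _ = Sink"

fun alt :: "node \<Rightarrow> node" where
  "alt (Level k j) = Level (k - 1) (\<not> level_ptr c k j)"
| "alt (Domino k g) = Signal k g (\<not> domino_ptr k g)"
| "alt (Watch k j i) = Level k j"
| "alt (Tail k j) = Domino k (R k - 1)"
| "alt (Dummy d) = Level 0 False"
| "alt _ = Sink"

fun improvable :: "node \<Rightarrow> bool" where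
  "improvable (Level k j) \<longleftrightarrow> 1 \<le> k \<and> k \<le> b \<and> stale c k j"
| "improvable (Domino k g) \<longleftrightarrow> k = \<kappa> \<and> g = \<gamma> \<and> \<gamma> < R \<kappa>"
| "improvable (Watch k j i) \<longleftrightarrow> 1 \<le> k \<and> k \<le> b \<and> (stale c k j \<longrightarrow> i = level_ptr c k j)"
| "improvable (Tail k j) \<longleftrightarrow> k \<le> b \<and> (k = \<kappa> \<and> \<gamma> < R \<kappa> \<longrightarrow> j \<noteq> dominant c k)"
| "improvable (Dummy d) \<longleftrightarrow> d < nD"
| "improvable _ \<longleftrightarrow> False"

section \<open>Valuations of all vertices in a counter state\<close>

definition signal_val :: "nat \<Rightarrow> nat \<Rightarrow> bool \<Rightarrow> real" where
  "signal_val k g j = 2 * real g + 1 + level_val c k (if g \<le> progress k then j else \<not> dominant c k)"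

fun node_val :: "node \<Rightarrow> real" where
  "node_val Sink = 0"
| "node_val (Level k j) = level_val c k j"
| "node_val (Signal k g j) = signal_val k g j"
| "node_val (Pad k g j) = 1 + signal_val k g j"
| "node_val (Domino k g) = 1 + signal_val k g (domino_ptr k g)"
| "node_val (Watch k j i) = 1 + level_val c (k - 1) i"
| "node_val (Tail k j) = 1 + level_val c k j"
| "node_val (Dummy d) = 1"
| "node_val (Filler d) = 1"

lemma less: "k \<le> b \<Longrightarrow> level_val c k (\<not> dominant c k) < level_val c k (dominant c k)"
  using level_val_less c_le by blast

lemma signal_val_0: "signal_val k 0 j = 1 + level_val c k j"
  by (simp add: signal_val_def)

text \<open>\<open>Pad\<close> and \<open>Domino\<close> both add weight 1, so player 1 just takes
  the smaller of the signals behind them. Beyond the first lagging domino, both signals therefore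
  inherit the worse value.\<close>

lemma signal_val_Suc:
  assumes "k \<le> b"
  shows "signal_val k (Suc g) j = 2 + min (signal_val k g j) (signal_val k g (domino_ptr k g))"
  using less[OF assms] by (cases "dominant c k"; cases j) (auto simp: signal_val_def domino_ptr_def Suc_le_eq)

definition represents :: "(nat \<Rightarrow> nat) \<Rightarrow> bool" where
  "represents \<sigma> \<longleftrightarrow> (\<forall>v. own0 v \<longrightarrow> \<sigma> (code v) = code (sel v))"

lemma sel_succs: "own0 v \<Longrightarrow> sel v \<in> succs v"
  by (cases v rule: succs.cases) auto

lemma represents_strategy0: "represents \<sigma> \<Longrightarrow> strategy0 G \<sigma>"
  using sel_succs by (auto simp: represents_def strategy0_def nodes_def)

lemma weight_val_code:
  assumes r: "represents \<sigma>" and v: "v \<in> nodes"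
  shows "weight G (val G \<sigma> (code v)) = node_val v"
proof -
  have "weight G (val G \<sigma> (code v)) = (node_val \<circ> from_nat) (code v)"
  proof (rule weight_val)
    show "strategy0 G \<sigma>" by (rule represents_strategy0[OF r])
    show "(node_val \<circ> from_nat) (sink G) = 0" by simp
    show "code v \<in> VG G" using v by (simp add: VG_eq)
    show "(node_val \<circ> from_nat) v = wt v + (node_val \<circ> from_nat) (\<sigma> v)" if v0: "v \<in> V0 G" for v
    proof -
      obtain u where u: "v = code u" "own0 u" using v0 by auto
      then have "node_val u = wt (code u) + node_val (sel u)" unfolding wt_code
        by (cases u rule: succs.cases) auto
      then show ?thesis using r u by (simp add: represents_def)
    qed
    fix v assume "v \<in> V1 G"
    then obtain u where u: "v = code u" "own1 u" by auto
    have le: "node_val u \<le> wt (code u) + node_val w" if "w \<in> succs u" for w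
      using u that unfolding wt_code by (cases u rule: succs.cases) (auto simp: level_weight_def signal_val_0 signal_val_Suc)
    then show "(node_val \<circ> from_nat) v \<le> wt v + (node_val \<circ> from_nat) w" if "(v, w) \<in> E G" for w
      using u that by (auto simp: in_E)
    have "\<exists>w \<in> succs u. node_val u = wt (code u) + node_val w"
      using u unfolding wt_code
      by (cases u rule: succs.cases) (auto simp: level_weight_def signal_val_0 signal_val_Suc min_def)
    then show "\<exists>w. (v, w) \<in> E G \<and> (node_val \<circ> from_nat) v = wt v + (node_val \<circ> from_nat) w"
      using u by (auto simp: in_E nodes_def)
  qed
  then show ?thesis by simp
qed

text \<open>Dominoes before the first lagging one already point to the better signal, and those
  after it see two equal signals. The alternative of a watcher passes through
  \<open>Level k j\<close> and gains its positive weight, unless that vertex points to the worse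
  successor and the watcher to the better one. The end of a chain is worth, up to
  \<open>2 * R k\<close>, the worse level vertex until the last domino has followed, and the better
  one from then on.\<close>

lemma improving_node:
  assumes v: "own0 v" and w: "w \<in> succs v"
  shows "node_val (sel v) < node_val w \<longleftrightarrow> improvable v \<and> w = alt v"
proof (cases v)
  case (Level k j)
  then obtain k' where k: "k = Suc k'" "k' < b" using v by (cases k) auto
  then show ?thesis using Level w v less[of k']
    by (cases "dominant c k'"; cases "stale c (Suc k') j") (auto simp: level_ptr_def)
next
  case (Domino k g)
  then have k: "k \<le> b" "g < R k" using v by auto
  have "progress k = R k" if "k \<noteq> \<kappa>" using that by (simp add: progress_def)
  then have "improvable v \<longleftrightarrow> g = progress k" using k Domino by (auto simp: progress_def)
  moreover have "w = alt v \<or> w = sel v" using w Domino by auto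
  moreover have "node_val (sel v) < node_val (alt v) \<longleftrightarrow> g = progress k"
    using less[OF k(1)] Domino
    by (cases "dominant c k"; cases g "progress k" rule: linorder_cases) (auto simp: signal_val_def domino_ptr_def)
  moreover have "sel v \<noteq> alt v" using Domino by simp
  ultimately show ?thesis by auto
next
  case (Watch k j i)
  then obtain k' where k: "k = Suc k'" "k' < b" using v by (cases k) auto
  \<comment> \<open>One level down, the margin is at least three times the weight of
    \<open>Level k True\<close>, so a detour through a stale level vertex never pays for a watcher
    at the better vertex.\<close>
  have "U ^ (b + 1 - k') = U * U ^ (b - k')" using k by (simp add: Suc_diff_le)
  moreover have "1 \<le> U ^ (b - k')" using U_ge(1) by (intro one_le_power) simp
  moreover have "4 * U ^ (b - k') \<le> U * U ^ (b - k')" using U_ge(1) by (intro mult_right_mono) auto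
  ultimately have "3 * U ^ (b - k') \<le> level_val c k' (dominant c k') - level_val c k' (\<not> dominant c k')" "1 \<le> U ^ (b - k')"
    using level_val_margin[of k' c, OF _ c_le] k by linarith+
  then have *: "level_weight k j + level_val c k' (\<not> dominant c k') < level_val c k' (dominant c k')" "0 < level_weight k j"
    unfolding level_weight_def k by auto
  show ?thesis using w Watch k *
    by (cases "dominant c k'"; cases i; cases "stale c (Suc k') j") (auto simp: level_ptr_def)
next
  case (Tail k j)
  then have k: "k \<le> b" using v by auto
  note m = level_val_margin[of k c, OF k c_le] U_pow_ge[OF k] U_ge(2)[OF k]
  \<comment> \<open>The choice of \<open>U\<close> keeps the weight \<open>2 * R k\<close> collected
    along the chain from closing the gap between the two level vertices.\<close>
  have d: "2 * real (R k) + level_val c k (\<not> dominant c k) \<le> level_val c k (dominant c k)" using m by linarith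
  have R1: "real (R k - Suc 0) = real (R k) - 1" using R_pos[of k] by (simp add: of_nat_diff)
  have "node_val (Domino k (R k - 1)) = 2 * real (R k) + level_val c k (if R k \<le> progress k then dominant c k else \<not> dominant c k)"
    using R_pos[of k] R1 by (auto simp: signal_val_def domino_ptr_def) 
  moreover have "R k \<le> progress k \<longleftrightarrow> \<not> (k = \<kappa> \<and> \<gamma> < R \<kappa>)" by (auto simp: progress_def)
  ultimately show ?thesis using w Tail k d less[OF k] R_pos[of k] by (cases "dominant c k"; cases j) auto
next
  case (Dummy d)
  then show ?thesis using w v by (auto simp: level_weight_def)
next
  case (Filler d)
  then show ?thesis using w by auto
qed (use v in auto)

lemma improvable_own0: "improvable v \<Longrightarrow> own0 v"
  using \<kappa>_le by (cases v) auto

lemma alt_succs: "own0 v \<Longrightarrow> alt v \<in> succs v"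
  by (cases v rule: succs.cases) auto

lemma improving_switches_eq:
  assumes r: "represents \<sigma>"
  shows "improving_switches G \<sigma> = (\<lambda>v. (code v, code (alt v))) ` {v. improvable v}"
proof (intro set_eqI)
  fix e :: "nat \<times> nat"
  have *: "val_less G (val G \<sigma> (\<sigma> (code v))) (val G \<sigma> (code w)) \<longleftrightarrow> improvable v \<and> w = alt v"
    if "own0 v" "w \<in> succs v" for v w
  proof -
    have v: "v \<in> nodes" using that by (simp add: nodes_def)
    have "\<sigma> (code v) = code (sel v)" using r that by (simp add: represents_def)
    then show ?thesis
      using weight_val_code[OF r succs_nodes[OF v sel_succs]] weight_val_code[OF r succs_nodes[OF v]]
        improving_node that by (simp add: val_less_def)
  qed
  show "e \<in> improving_switches G \<sigma> \<longleftrightarrow> e \<in> (\<lambda>v. (code v, code (alt v))) ` {v. improvable v}"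
    using * improvable_own0 alt_succs
    by (auto simp: improving_switches_def improving_def p0_edges_eq)
qed

text \<open>Each improving level or domino vertex takes the place of exactly one watcher or tail vertex,
  so the number of improving switches does not depend on the state.\<close>

definition base :: "node set" where
  "base = {v. (\<exists>k j i. v = Watch k j i \<and> 1 \<le> k \<and> k \<le> b) \<or> (\<exists>k j. v = Tail k j \<and> k \<le> b) \<or> (\<exists>d<nD. v = Dummy d)}"

text \<open>For a stale level vertex, exactly the watcher at the better vertex below stops
  improving; for a lagging chain, exactly the tail at the better vertex of its level does.\<close>

fun replacement :: "node \<Rightarrow> node" where
  "replacement (Watch k j i) = (if stale c k j \<and> i \<noteq> level_ptr c k j then Level k j else Watch k j i)"
| "replacement (Tail k j) = (if k = \<kappa> \<and> \<gamma> < R \<kappa> \<and> j = dominant c k then Domino \<kappa> \<gamma> else Tail k j)"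
| "replacement v = v"

lemma replacement_base: "replacement ` base = {v. improvable v}"
proof
  show "replacement ` base \<subseteq> {v. improvable v}" by (auto simp: base_def)
  show "{v. improvable v} \<subseteq> replacement ` base"
  proof
    fix v assume "v \<in> {v. improvable v}"
    then have v: "improvable v" by simp
    show "v \<in> replacement ` base"
    proof (cases v)
      case (Level k j)
      then have "v = replacement (Watch k j (\<not> level_ptr c k j))" "Watch k j (\<not> level_ptr c k j) \<in> base"
        using v by (auto simp: base_def)
      then show ?thesis by blast
    next
      case (Domino k g)
      then have "v = replacement (Tail k (dominant c k))" "Tail k (dominant c k) \<in> base"
        using v \<kappa>_le by (auto simp: base_def)
      then show ?thesis by blast
    next
      case (Watch k j i)
      then have "v = replacement v" "v \<in> base" using v by (auto simp: base_def)
      then show ?thesis by blast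
    next
      case (Tail k j)
      then have "v = replacement v" "v \<in> base" using v by (auto simp: base_def)
      then show ?thesis by blast
    next
      case (Dummy d)
      then have "v = replacement v" "v \<in> base" using v by (auto simp: base_def)
      then show ?thesis by blast
    qed (use v in auto)
  qed
qed

lemma inj_replacement: "inj_on replacement base"
  by (auto simp: inj_on_def base_def split: if_splits)

text \<open>The summand \<open>6 * b + 2\<close> stands for four watchers at each of the levels
  \<open>1..b\<close> and two tails at each of the levels \<open>0..b\<close>.\<close>

lemma card_base: "card base = nD + (6 * b + 2)"
proof -
  have "base = (\<lambda>(k, j, i). Watch k j i) ` ({1..b} \<times> UNIV \<times> UNIV) \<union>
      ((\<lambda>(k, j). Tail k j) ` ({..b} \<times> UNIV) \<union> Dummy ` {..<nD})"
    by (auto simp: base_def image_iff)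
  also have "card \<dots> = card ((\<lambda>(k, j, i). Watch k j i) ` ({1..b} \<times> (UNIV :: bool set) \<times> (UNIV :: bool set)))
      + card ((\<lambda>(k, j). Tail k j) ` ({..b} \<times> UNIV) \<union> Dummy ` {..<nD})"
    by (rule card_Un_disjoint) auto
  also have "card ((\<lambda>(k, j). Tail k j) ` ({..b} \<times> UNIV) \<union> Dummy ` {..<nD}) =
      card ((\<lambda>(k, j). Tail k j) ` ({..b} \<times> (UNIV :: bool set))) + card (Dummy ` {..<nD})"
    by (rule card_Un_disjoint) auto
  finally show ?thesis
    by (simp add: card_image inj_on_def card_cartesian_product card_UNIV_bool
      del: UNIV_Times_UNIV)
qed

lemma card_improvable: "card {v. improvable v} = nD + (6 * b + 2)"
  using card_image[OF inj_replacement] replacement_base card_base by metis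

lemma finite_improvable: "finite {v. improvable v}"
  by (rule finite_subset[OF _ finite_own0]) (use improvable_own0 in auto)

end

section \<open>Bland numbers for a given rule\<close>

lemma digit_less: "a < a' \<Longrightarrow> r < M \<Longrightarrow> a * M + r < a' * M + (r' :: nat)"
  by (metis add.commute add_less_mono1 le_add1 less_le_trans mult_Suc mult_le_mono1 Suc_leI)

lemma digit_eq:
  fixes a :: nat
  assumes "a * M + r = a' * M + r'" "r < M" "r' < M"
  shows "a = a'" "r = r'"
proof -
  show "a = a'" using digit_less[of a a' r M r'] digit_less[of a' a r' M r] assms
    by (metis less_irrefl linorder_neqE_nat)
  then show "r = r'" using assms by simp
qed

text \<open>\<open>idx\<close> and \<open>nxt\<close> are the index and memory output of the rule for the constant number of improving
  switches. Levels are switched only in memory state \<open>hs\<close>; the indices in the other \<open>r\<close> states of the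
  period avoid the gap above \<open>s\<close> that is occupied by levels, watchers and tails.\<close>

locale counter_rule = counter +
  fixes idx nxt :: "nat \<Rightarrow> nat" and r hs s :: nat
  assumes R_Suc: "R (Suc k) = r"
    and pre: "(nxt ^^ R 0) 1 = hs"
    and cyc: "(nxt ^^ Suc r) hs = hs"
    and s: "idx hs = s" "1 \<le> s" "s \<le> nD + 1"
    and idx_pre: "\<And>g. g < R 0 \<Longrightarrow> 1 \<le> idx ((nxt ^^ g) 1) \<and> idx ((nxt ^^ g) 1) \<le> nD + (6 * b + 2)"
    and idx_cyc: "\<And>g. g < r \<Longrightarrow> 1 \<le> idx ((nxt ^^ Suc g) hs) \<and> idx ((nxt ^^ Suc g) hs) \<le> nD + (6 * b + 2)
      \<and> (idx ((nxt ^^ Suc g) hs) \<le> s \<or> s + (6 * b + 2) \<le> idx ((nxt ^^ Suc g) hs))"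
begin

text \<open>For \<kappa> \<noteq> 0 the extra iteration accounts for the level switch itself, which
  is made in state \<open>hs\<close>.\<close>

definition memory :: "nat \<Rightarrow> nat \<Rightarrow> nat" where
  "memory \<kappa> \<gamma> = (if \<kappa> = 0 then (nxt ^^ \<gamma>) 1 else (nxt ^^ Suc \<gamma>) hs)"

lemma memory_R: "memory \<kappa> (R \<kappa>) = hs"
  using pre cyc R_Suc by (cases \<kappa>) (auto simp: memory_def)

lemma memory_Suc: "memory \<kappa> (Suc \<gamma>) = nxt (memory \<kappa> \<gamma>)"
  by (simp add: memory_def)

definition B :: nat where
  "B = Suc (sum code nodes)"

lemma finite_nodes: "finite nodes"
proof -
  have "nodes = {v. own0 v} \<union> {v. own1 v} \<union> {Sink}" by (auto simp: nodes_def)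
  then show ?thesis using finite_own0 finite_own1 by simp
qed

lemma code_less_B: "v \<in> nodes \<Longrightarrow> code v < B"
  unfolding B_def less_Suc_eq_le using finite_nodes by (intro member_le_sum) auto

text \<open>Coarse order of the Bland numbers: \<open>s - 1\<close> dummies; level vertices, topmost
  level first and \<open>False\<close> before \<open>True\<close>; watchers and tails on one common
  slot; the remaining dummies. Dummies have odd slots. A domino gets an even slot among them with
  \<open>i - 1\<close> improving vertices below; for large \<open>i\<close> these include the whole
  middle block, which explains the shift by \<open>6 * b + 2\<close>.\<close>

fun slot :: "node \<Rightarrow> nat" where
  "slot (Dummy d) = (if d < s - 1 then 2 * d + 1 else 2 * s + 2 * b + 1 + 2 * (d - (s - 1)))"
| "slot (Level k j) = 2 * s - 1 + 2 * (b - k) + (if j then 1 else 0)"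
| "slot (Domino k g) = (let i = idx (memory k g) in
     if i \<le> s then 2 * (i - 1) else 2 * s + 2 * b + 2 * (i - (6 * b + 2) - (s - 1)))"
| "slot (Filler d) = 0"
| "slot _ = 2 * s + 2 * b - 1"

text \<open>Lexicographic: the slot decides, and ties are broken by the code.\<close>

definition slot_code :: "node \<Rightarrow> nat" where
  "slot_code v = slot v * B + code v"

lemma slot_code_inj: "u \<in> nodes \<Longrightarrow> v \<in> nodes \<Longrightarrow> slot_code u = slot_code v \<Longrightarrow> u = v"
  unfolding slot_code_def using digit_eq(2) code_less_B code_eq by blast

lemma slot_code_less: "slot u < slot v \<Longrightarrow> u \<in> nodes \<Longrightarrow> slot_code u < slot_code v"
  unfolding slot_code_def using digit_less code_less_B by blast

abbreviation c0 :: "nat \<Rightarrow> nat" where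
  "c0 \<equiv> (\<lambda>_. 2)"

text \<open>During the preperiod, the improving vertices other than the current domino.\<close>

definition F0 :: "node set" where
  "F0 = {v. case v of Dummy d \<Rightarrow> d < nD | Tail k j \<Rightarrow> k \<le> b \<and> \<not> (k = 0 \<and> j)
     | Level k j \<Rightarrow> 1 \<le> k \<and> k \<le> b | Watch k j i \<Rightarrow> 1 \<le> k \<and> k \<le> b \<and> \<not> i | _ \<Rightarrow> False}"

lemma initial_state: "\<gamma> \<le> R 0 \<Longrightarrow> counter_state b R c0 0 \<gamma>"
  by unfold_locales auto

lemma improvable_initial:
  assumes "\<gamma> < R 0"
  shows "{v. counter_state.improvable b nD R c0 0 \<gamma> v} = insert (Domino 0 \<gamma>) F0"
proof (intro set_eqI)
  interpret st: counter_state b nD nF R c0 0 \<gamma> using initial_state assms by simp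
  fix v
  show "v \<in> {v. st.improvable v} \<longleftrightarrow> v \<in> insert (Domino 0 \<gamma>) F0"
    using assms by (cases v) (auto simp: F0_def stale_def level_ptr_def dominant_def)
qed

lemma F0_nodes: "F0 \<subseteq> nodes"
proof
  fix v assume "v \<in> F0"
  then show "v \<in> nodes" by (cases v) (auto simp: F0_def nodes_def)
qed

lemma card_F0: "card F0 = nD + (6 * b + 2) - 1"
proof -
  interpret st: counter_state b nD nF R c0 0 0 using initial_state by simp
  have "Domino 0 0 \<notin> F0" by (simp add: F0_def)
  then show ?thesis
    using st.card_improvable improvable_initial[OF R_pos] finite_subset[OF F0_nodes finite_nodes]
    by (simp add: card_insert_if)
qed

text \<open>The competitors \<open>F0\<close> stay the same during the whole preperiod, so each
  level 0 domino can be given a threshold that realises whatever index the rule asks for.\<close>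

definition \<theta> :: "nat \<Rightarrow> nat" where
  "\<theta> g = (SOME \<theta>. card {v \<in> F0. slot_code v < \<theta>} = idx (memory 0 g) - 1)"

lemma \<theta>: 
  assumes "g < R 0"
  shows "card {v \<in> F0. slot_code v < \<theta> g} = idx (memory 0 g) - 1"
proof -
  have "inj_on slot_code F0" using slot_code_inj F0_nodes by (auto simp: inj_on_def)
  moreover have "idx (memory 0 g) \<le> nD + (6 * b + 2)" using idx_pre[OF assms] by (simp add: memory_def)
  then have "idx (memory 0 g) - 1 \<le> card F0" unfolding card_F0 by linarith
  ultimately show ?thesis unfolding \<theta>_def
    using someI_ex[OF ex_threshold[OF finite_subset[OF F0_nodes finite_nodes]]] by blast
qed

text \<open>Doubling frees an odd number between consecutive slot codes, and level 0 dominoes are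
  inserted there at their thresholds.\<close>

definition key :: "node \<Rightarrow> nat" where
  "key v = (case v of Domino k g \<Rightarrow> if k = 0 then 2 * \<theta> g + 1 else 2 * slot_code v + 2 | _ \<Rightarrow> 2 * slot_code v + 2)"

lemma key_eq: "(\<And>g. v \<noteq> Domino 0 g) \<Longrightarrow> key v = 2 * slot_code v + 2"
  by (cases v) (auto simp: key_def)

text \<open>The part below \<open>B * B\<close> encodes the edge and makes the numbers distinct; the
  order is decided by \<open>key\<close> whenever keys differ.\<close>

fun bl :: "nat \<times> nat \<Rightarrow> nat" where
  "bl (x, y) = key (from_nat x) * (B * B) + (x * B + y) + 1"

lemma bl_inj: "inj_on bl (p0_edges G)"
proof (rule inj_onI)
  fix e e' assume e: "e \<in> p0_edges G" "e' \<in> p0_edges G" "bl e = bl e'"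
  have *: "p0_edges G \<subseteq> code ` nodes \<times> code ` nodes"
    using closed by (auto simp: p0_edges_def VG_eq)
  obtain v w v' w' where v: "e = (code v, code w)" "e' = (code v', code w')"
      "v \<in> nodes" "w \<in> nodes" "v' \<in> nodes" "w' \<in> nodes" using e * by blast
  have lt: "code v * B + code w < B * B" "code v' * B + code w' < B * B"
    using digit_less[of "code v" B "code w" B 0] digit_less[of "code v'" B "code w'" B 0] code_less_B v
    by auto
  have "code v * B + code w = code v' * B + code w'"
    using digit_eq(2)[OF _ lt] e v by simp
  then show "e = e'" using digit_eq[of "code v" B "code w"] code_less_B v by blast
qed

lemma bl_less:
  assumes "key u < key v" "u \<in> nodes" "u' \<in> nodes"
  shows "bl (code u, code u') < bl (code v, y)"
  using digit_less[OF assms(1), of "code u * B + code u'" "B * B" "code v * B + y"]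
    digit_less[of "code u" B "code u'" B 0] code_less_B assms by simp

lemma bland: "bland_numbering G bl"
  unfolding bland_numbering_def using bl_inj by auto

end

section \<open>The switch selected in each state\<close>

locale counter_rule_state = counter_rule + counter_state
begin

lemma select:
  assumes rep: "represents \<sigma>" and v: "improvable v"
    and ne: "\<And>u. improvable u \<Longrightarrow> u \<noteq> v \<Longrightarrow> key u \<noteq> key v"
    and card: "card {u. improvable u \<and> key u < key v} = i - 1"
  shows "ith_smallest bl (improving_switches G \<sigma>) i = (code v, code (alt v))"
proof (rule ith_smallestI)
  let ?I = "improving_switches G \<sigma>" and ?e = "\<lambda>v. (code v, code (alt v))"
  note I = improving_switches_eq[OF rep]
  show "finite ?I" unfolding I using finite_improvable by simp
  have "?I \<subseteq> p0_edges G" by (auto simp: improving_switches_def improving_def)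
  then show inj: "inj_on bl ?I" using bl_inj inj_on_subset by blast
  show "?e v \<in> ?I" unfolding I using v by simp
  have nd: "u \<in> nodes" "alt u \<in> nodes" if "improvable u" for u
    using that improvable_own0 succs_nodes alt_succs by (auto simp: nodes_def)
  have lt: "bl (?e u) < bl (?e v) \<longleftrightarrow> key u < key v" if u: "improvable u" for u
  proof
    show "key u < key v \<Longrightarrow> bl (?e u) < bl (?e v)" using bl_less nd u by blast
    assume l: "bl (?e u) < bl (?e v)"
    then have "u \<noteq> v" by auto
    then have "key u < key v \<or> key v < key u" using ne[OF u] by linarith
    then show "key u < key v" using bl_less[of v u "alt v" "code (alt u)"] nd[OF v] l by linarith
  qed
  have "{e' \<in> ?I. bl e' < bl (?e v)} = ?e ` {u. improvable u \<and> key u < key v}"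
    unfolding I using lt by auto
  then show "card {e' \<in> ?I. bl e' < bl (?e v)} = i - 1"
    using card by (simp add: card_image inj_on_def)
qed

lemma key_less: "(\<And>g. u \<noteq> Domino 0 g) \<Longrightarrow> (\<And>g. v \<noteq> Domino 0 g) \<Longrightarrow> u \<in> nodes \<Longrightarrow> slot u < slot v \<Longrightarrow> key u < key v"
  using slot_code_less by (simp add: key_eq)

lemma improvable_nodes: "improvable u \<Longrightarrow> u \<in> nodes"
  using improvable_own0 by (simp add: nodes_def)

text \<open>Ties among the other vertices, such as watchers and tails, do not affect the rank of
  \<open>v\<close>; only its own slot must not be shared.\<close>

lemma select_slot:
  assumes rep: "represents \<sigma>" and v: "improvable v" "\<And>g. v \<noteq> Domino 0 g"
    and d: "\<And>g. \<not> improvable (Domino 0 g)"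
    and ne: "\<And>u. improvable u \<Longrightarrow> u \<noteq> v \<Longrightarrow> slot u \<noteq> slot v"
    and card: "card {u. improvable u \<and> slot u < slot v} = i - 1"
  shows "ith_smallest bl (improving_switches G \<sigma>) i = (code v, code (alt v))"
proof (rule select[OF rep v(1)])
  have *: "key u < key v \<longleftrightarrow> slot u < slot v" "key u \<noteq> key v" if u: "improvable u" "u \<noteq> v" for u
  proof -
    have "\<And>g. u \<noteq> Domino 0 g" using u(1) d by blast
    then have "slot u < slot v \<Longrightarrow> key u < key v" "slot v < slot u \<Longrightarrow> key v < key u"
      using key_less[of u v] key_less[of v u] v u improvable_nodes by auto
    then show "key u < key v \<longleftrightarrow> slot u < slot v" "key u \<noteq> key v" using ne[OF u] by linarith+
  qed
  show "\<And>u. improvable u \<Longrightarrow> u \<noteq> v \<Longrightarrow> key u \<noteq> key v" using * by blast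
  have "key u < key v \<longleftrightarrow> slot u < slot v" if "improvable u" for u
    using *(1)[OF that] by (cases "u = v") simp_all
  then have "{u. improvable u \<and> key u < key v} = {u. improvable u \<and> slot u < slot v}"
    by (intro Collect_cong conj_cong) simp_all
  then show "card {u. improvable u \<and> key u < key v} = i - 1" using card by simp
qed

lemma select_chain_0:
  assumes rep: "represents \<sigma>" and 0: "\<kappa> = 0" "\<gamma> < R 0" "c = c0"
  shows "ith_smallest bl (improving_switches G \<sigma>) (idx (memory \<kappa> \<gamma>)) = (code (Domino \<kappa> \<gamma>), code (alt (Domino \<kappa> \<gamma>)))"
proof (rule select[OF rep])
  let ?v = "Domino 0 \<gamma>"
  have imp: "{u. improvable u} = insert ?v F0" using improvable_initial 0 by simp
  have F0: "\<And>g. u \<noteq> Domino 0 g" if "u \<in> F0" for u using that by (auto simp: F0_def)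
  show "improvable (Domino \<kappa> \<gamma>)" unfolding improvable.simps using 0 by simp
  have key: "key u < key ?v \<longleftrightarrow> slot_code u < \<theta> \<gamma>" "key u \<noteq> key ?v" if "u \<in> F0" for u
  proof -
    have e: "key u = 2 * slot_code u + 2" using key_eq F0[OF that] by blast
    have e': "key ?v = 2 * \<theta> \<gamma> + 1" by (simp add: key_def)
    show "key u < key ?v \<longleftrightarrow> slot_code u < \<theta> \<gamma>" unfolding e e' by linarith
    show "key u \<noteq> key ?v" unfolding e e' by presburger
  qed
  show "key u \<noteq> key (Domino \<kappa> \<gamma>)" if "improvable u" "u \<noteq> Domino \<kappa> \<gamma>" for u
    using key(2)[of u] imp that 0 by blast
  have "improvable u \<and> key u < key ?v \<longleftrightarrow> u \<in> F0 \<and> slot_code u < \<theta> \<gamma>" for u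
  proof (cases "u \<in> F0")
    case True
    then have "improvable u" using imp by blast
    then show ?thesis using True key(1) by simp
  next
    case False
    then have "improvable u \<longrightarrow> u = ?v" using imp by blast
    then show ?thesis using False by auto
  qed
  then have "{u. improvable u \<and> key u < key ?v} = {u \<in> F0. slot_code u < \<theta> \<gamma>}"
    by (intro Collect_cong)
  then show "card {u. improvable u \<and> key u < key (Domino \<kappa> \<gamma>)} = idx (memory \<kappa> \<gamma>) - 1"
    using \<theta>[OF 0(2)] 0 by simp
qed

lemma select_chain_Suc:
  assumes rep: "represents \<sigma>" and k: "\<kappa> \<noteq> 0" "\<gamma> < R \<kappa>"
  shows "ith_smallest bl (improving_switches G \<sigma>) (idx (memory \<kappa> \<gamma>)) = (code (Domino \<kappa> \<gamma>), code (alt (Domino \<kappa> \<gamma>)))"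
proof (rule select_slot[OF rep])
  let ?v = "Domino \<kappa> \<gamma>"
  define i where "i = idx (memory \<kappa> \<gamma>)"
  have "\<gamma> < r" using k R_Suc by (cases \<kappa>) auto
  then have i: "1 \<le> i" "i \<le> nD + (6 * b + 2)" "i \<le> s \<or> s + (6 * b + 2) \<le> i"
    using idx_cyc k by (auto simp: i_def memory_def)
  have Kv: "slot ?v = (if i \<le> s then 2 * (i - 1) else 2 * s + 2 * b + 2 * (i - (6 * b + 2) - (s - 1)))"
    by (simp add: i_def Let_def)
  show imp: "improvable ?v" using k by simp
  show "\<And>g. ?v \<noteq> Domino 0 g" "\<And>g. \<not> improvable (Domino 0 g)" using k by auto
  show "slot u \<noteq> slot ?v" if u: "improvable u" "u \<noteq> ?v" for u
  proof (cases u)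
    case (Dummy d)
    have "odd (slot u)" unfolding Dummy slot.simps by simp
    moreover have "even (slot ?v)" unfolding Kv by simp
    ultimately show ?thesis by metis
  next
    case (Level m j)
    then show ?thesis unfolding Kv unfolding Level slot.simps using u s i by auto
  next
    case (Watch m j i')
    then show ?thesis unfolding Kv unfolding Watch slot.simps using u s i by auto
  next
    case (Tail m j)
    then show ?thesis unfolding Kv unfolding Tail slot.simps using u s i by auto
  qed (use u in auto)
  show "card {u. improvable u \<and> slot u < slot ?v} = idx (memory \<kappa> \<gamma>) - 1"
  proof (cases "i \<le> s")
    case True
    have "improvable u \<and> slot u < slot ?v \<longleftrightarrow> u \<in> Dummy ` {..<i - 1}" for u
      unfolding Kv using True s i \<open>\<kappa> \<noteq> 0\<close>
      by (cases u) (auto simp: i_def[symmetric] Let_def)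
    then have "{u. improvable u \<and> slot u < slot ?v} = Dummy ` {..<i - 1}" by blast
    then show ?thesis by (simp add: card_image inj_on_def i_def)
  next
    case False
    \<comment> \<open>Above the gap it is easier to count the complement: besides the domino itself,
      only the dummies from \<open>i - (6 * b + 2)\<close> on are not below.\<close>
    have "improvable u \<and> slot u < slot ?v \<longleftrightarrow> improvable u \<and> u \<noteq> ?v \<and> u \<notin> Dummy ` {i - (6 * b + 2)..<nD}" for u
      unfolding Kv using False s i by (cases u) (auto simp: i_def[symmetric] Let_def split: if_splits)
    then have "{u. improvable u \<and> slot u < slot ?v} = {u. improvable u} - insert ?v (Dummy ` {i - (6 * b + 2)..<nD})"
      by blast
    moreover have "card \<dots> = card {u. improvable u} - card (insert ?v (Dummy ` {i - (6 * b + 2)..<nD}))"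
      by (rule card_Diff_subset) (use imp in auto)
    moreover have "card (insert ?v (Dummy ` {i - (6 * b + 2)..<nD})) = Suc (nD - (i - (6 * b + 2)))"
      by (subst card_insert_disjoint) (auto simp: card_image inj_on_def)
    ultimately show ?thesis using i False unfolding card_improvable i_def[symmetric] by simp
  qed
qed

text \<open>Levels above \<open>k\<close> have no stale vertex. At level \<open>k\<close>, only
  \<open>True\<close> is stale if \<open>c k = 1\<close>, and otherwise \<open>False\<close> comes
  first. So just the first \<open>s - 1\<close> dummies lie below.\<close>

lemma select_core:
  assumes rep: "represents \<sigma>" and q: "\<gamma> = R \<kappa>" and k: "1 \<le> k" "k \<le> b" "c k \<noteq> 0"
    and top: "\<And>m. k < m \<Longrightarrow> m \<le> b \<Longrightarrow> c m = 0"
  shows "ith_smallest bl (improving_switches G \<sigma>) (idx hs) =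
    (code (Level k (c k = 1)), code (alt (Level k (c k = 1))))"
proof (rule select_slot[OF rep])
  let ?v = "Level k (c k = 1)"
  show v: "improvable ?v" using k c_le[of k] by (auto simp: stale_def)
  show "\<And>g. ?v \<noteq> Domino 0 g" by simp
  show "\<And>g. \<not> improvable (Domino 0 g)" unfolding improvable.simps using q by simp
  have lev: "slot ?v < slot (Level m j)" if "improvable (Level m j)" "Level m j \<noteq> ?v" for m j
  proof -
    have st: "1 \<le> m" "m \<le> b" "stale c m j" using that by auto
    then have "c m \<noteq> 0" by (auto simp: stale_def split: if_splits)
    then have "m \<le> k" using top st by (metis not_less)
    moreover have "j \<and> c k \<noteq> 1" if "m = k"
      using st that \<open>Level m j \<noteq> ?v\<close> by (auto simp: stale_def split: if_splits)
    ultimately show ?thesis using k by (cases "m = k") auto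
  qed
  have wt: "slot ?v < 2 * s + 2 * b - 1" using k s by auto
  have *: "slot u < slot ?v \<longleftrightarrow> u \<in> Dummy ` {..<s - 1}" "slot u \<noteq> slot ?v" if u: "improvable u" "u \<noteq> ?v" for u
  proof -
    have "(slot u < slot ?v \<longleftrightarrow> u \<in> Dummy ` {..<s - 1}) \<and> slot u \<noteq> slot ?v"
    proof (cases u)
      case (Level m j)
      then show ?thesis using lev[of m j] u by auto
    next
      case (Dummy d)
      then show ?thesis using wt s by (auto split: if_splits)
    next
      case (Domino m g)
      then show ?thesis using q u(1) unfolding Domino improvable.simps by simp
    qed (use wt u in auto)
    then show "slot u < slot ?v \<longleftrightarrow> u \<in> Dummy ` {..<s - 1}" "slot u \<noteq> slot ?v" by auto
  qed
  show "\<And>u. improvable u \<Longrightarrow> u \<noteq> ?v \<Longrightarrow> slot u \<noteq> slot ?v" using *(2) .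
  have "{u. improvable u \<and> slot u < slot ?v} = Dummy ` {..<s - 1}"
    using *(1) s by (auto simp del: slot.simps) 
  then show "card {u. improvable u \<and> slot u < slot ?v} = idx hs - 1"
    using s by (simp add: card_image inj_on_def)
qed

end

section \<open>The run of the counter\<close>

context counter_rule_state
begin

lemma chain_step:
  assumes rep: "represents \<sigma>" and q: "\<gamma> < R \<kappa>"
  shows "counter_state b R c \<kappa> (Suc \<gamma>)"
    and "counter_state.represents b nD nF R c \<kappa> (Suc \<gamma>)
      (\<sigma>(code (Domino \<kappa> \<gamma>) := code (alt (Domino \<kappa> \<gamma>))))"
proof -
  show "counter_state b R c \<kappa> (Suc \<gamma>)" by unfold_locales (use c_le \<kappa>_le q in auto)
  then interpret nx: counter_state b nD nF R c \<kappa> "Suc \<gamma>" by simp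
  have "nx.sel v = (if v = Domino \<kappa> \<gamma> then alt v else sel v)" if "own0 v" for v
    by (cases v) (auto simp: domino_ptr_def nx.domino_ptr_def progress_def nx.progress_def)
  then show "nx.represents (\<sigma>(code (Domino \<kappa> \<gamma>) := code (alt (Domino \<kappa> \<gamma>))))"
    using rep unfolding represents_def nx.represents_def by auto
qed

text \<open>The switch changes which vertex is better at level \<open>k\<close> and at no other
  level. At level \<open>k + 1\<close>, dominance below and staleness flip together, so the pointers
  stay put while both vertices become stale. In the same way all dominoes of level \<open>k\<close>
  keep their pointers but now lag.\<close>

lemma core_step:
  assumes rep: "represents \<sigma>" and q: "\<gamma> = R \<kappa>" and k: "1 \<le> k" "k \<le> b" "c k \<noteq> 0"
    and top: "\<And>m. k < m \<Longrightarrow> m \<le> b \<Longrightarrow> c m = 0"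
  defines "c' \<equiv> c(k := c k - 1, Suc k := 2)"
  shows "counter_state b R c' k 0"
    and "counter_state.represents b nD nF R c' k 0
      (\<sigma>(code (Level k (c k = 1)) := code (alt (Level k (c k = 1)))))"
proof -
  show "counter_state b R c' k 0"
  proof
    show "c' m \<le> 2" for m
      using c_le[of m] order_trans[OF diff_le_self c_le[of k]] by (simp add: c'_def)
  qed (use k in auto)
  then interpret nx: counter_state b nD nF R c' k 0 by simp
  have ck: "c k = 1 \<or> c k = 2" using c_le[of k] k by linarith
  have dominant': "dominant c' m = (dominant c m \<noteq> (m = k))" if "m \<le> b" for m
    using that ck k top[of "Suc k"] by (auto simp: dominant_def c'_def)
  have st': "stale c' (Suc k) j" "Suc k \<le> b \<Longrightarrow> \<not> stale c (Suc k) j" for j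
    using top[of "Suc k"] by (auto simp: stale_def c'_def)
  have st'': "stale c' m j = stale c m j" if "m \<noteq> k" "m \<noteq> Suc k" for m j
    using that by (auto simp: stale_def c'_def)
  have stk: "stale c' k j = (stale c k j \<noteq> (j = (c k = 1)))" for j
    using ck by (auto simp: stale_def c'_def)
  have level_ptr': "level_ptr c' m j = (level_ptr c m j \<noteq> (m = k \<and> j = (c k = 1)))" if m: "1 \<le> m" "m \<le> b" for m j
  proof -
    consider "m = k" | "m = Suc k" | "m \<noteq> k" "m \<noteq> Suc k" by blast
    then show ?thesis
    proof cases
      case 1
      have "dominant c' (k - 1) = dominant c (k - 1)" using dominant'[of "k - 1"] k by (cases k) auto
      then show ?thesis unfolding level_ptr_def 1 stk by blast
    next
      case 2
      have "dominant c' k = (\<not> dominant c k)" using dominant'[of k] k by simp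
      then show ?thesis using st' m unfolding level_ptr_def 2 by simp
    next
      case 3
      have "dominant c' (m - 1) = dominant c (m - 1)" using dominant'[of "m - 1"] 3 m by auto
      then show ?thesis unfolding level_ptr_def st''[OF 3] using 3 by blast
    qed
  qed
  have dp: "nx.domino_ptr m g = domino_ptr m g" if "m \<le> b" "g < R m" for m g
  proof -
    have "progress m = R m" unfolding progress_def using q by simp
    then show ?thesis using that dominant'[of m] by (auto simp: domino_ptr_def nx.domino_ptr_def nx.progress_def)
  qed
  have "nx.sel v = (if v = Level k (c k = 1) then alt v else sel v)" if "own0 v" for v
    using that level_ptr' dp by (cases v) auto
  then show "nx.represents (\<sigma>(code (Level k (c k = 1)) := code (alt (Level k (c k = 1)))))"
    using rep unfolding represents_def nx.represents_def by auto
qed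

end

context counter_rule
begin

text \<open>A core step at level \<open>k\<close> is followed by two core steps at level \<open>k + 1\<close>; the potential
  counts the core steps that are still to come.\<close>

definition potential :: "(nat \<Rightarrow> nat) \<Rightarrow> nat" where
  "potential c = (\<Sum>k = 1..Suc b. c k * (2 ^ (Suc b - k) - 1))"

text \<open>The coefficients satisfy \<open>?w k = 1 + 2 * ?w (Suc k)\<close>, so one unit at level
  \<open>k\<close> pays for two units above it and for the step. Level \<open>Suc b\<close> has
  coefficient 0, which covers \<open>k = b\<close>.\<close>

lemma potential_step:
  assumes k: "1 \<le> k" "k \<le> b" "c k \<noteq> 0" and top: "\<And>m. k < m \<Longrightarrow> m \<le> b \<Longrightarrow> c m = 0"
  shows "potential c = Suc (potential (c(k := c k - 1, Suc k := 2)))"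
proof -
  let ?c = "c(k := c k - 1, Suc k := 2)"
  let ?w = "\<lambda>k. 2 ^ (Suc b - k) - 1 :: nat"
  let ?A = "{1..Suc b} - {k} - {Suc k}"
  have split: "potential d = d k * ?w k + (d (Suc k) * ?w (Suc k) + (\<Sum>m\<in>?A. d m * ?w m))" for d
    unfolding potential_def using k
    by (subst sum.remove[of _ k], simp, simp, subst sum.remove[of _ "Suc k"]) auto
  have "(\<Sum>m\<in>?A. ?c m * ?w m) = (\<Sum>m\<in>?A. c m * ?w m)" by (rule sum.cong) auto
  moreover have "c (Suc k) * ?w (Suc k) = 0" using top[of "Suc k"] k by (cases "k = b") auto
  moreover have "Suc b - k = Suc (Suc b - Suc k)" using k by simp
  then have "(2::nat) ^ (Suc b - k) = 2 * 2 ^ (Suc b - Suc k)" by (simp only: power_Suc)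
  then have "?w k = Suc (2 * ?w (Suc k))"
    using one_le_power[of "2::nat" "Suc b - Suc k", OF one_le_numeral] by linarith
  moreover obtain a where "c k = Suc a" using k by (cases "c k") auto
  ultimately show ?thesis unfolding split[of c] split[of ?c] by simp
qed

text \<open>Domino moves keep the potential and level switches lower it by one. The chain of level 0
  is active only before the first level switch, hence with the initial \<open>c\<close>.\<close>

lemma run_step:
  assumes P: "\<And>h. P (nD + (6 * b + 2)) (num_p0_edges G) h = (idx h, nxt h)"
    and st: "counter_state b R c \<kappa> \<gamma>" and rep: "counter_state.represents b nD nF R c \<kappa> \<gamma> \<sigma>"
    and \<kappa>: "\<kappa> = 0 \<Longrightarrow> c = c0" and potential: "0 < potential c"
  shows "\<exists>c' \<kappa>' \<gamma>' \<sigma>'. rule_step G bl P (\<sigma>, memory \<kappa> \<gamma>) = (\<sigma>', memory \<kappa>' \<gamma>') \<and> counter_state b R c' \<kappa>' \<gamma>' \<and>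
    counter_state.represents b nD nF R c' \<kappa>' \<gamma>' \<sigma>' \<and> (\<kappa>' = 0 \<longrightarrow> c' = c0) \<and> potential c \<le> Suc (potential c')"
proof -
  interpret st: counter_state b nD nF R c \<kappa> \<gamma> using st by simp
  interpret st: counter_rule_state b nD nF R idx nxt r hs s c \<kappa> \<gamma> ..
  note I = st.improving_switches_eq[OF rep]
  have card: "card (improving_switches G \<sigma>) = nD + (6 * b + 2)"
    unfolding I using st.card_improvable by (subst card_image) (auto simp: inj_on_def)
  then have "improving_switches G \<sigma> \<noteq> {}" by auto
  then have step: "rule_step G bl P (\<sigma>, h) =
      (apply_switch \<sigma> (ith_smallest bl (improving_switches G \<sigma>) (idx h)), nxt h)" for h
    using P by (simp add: rule_step_def card Let_def)
  show ?thesis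
  proof (cases "\<gamma> < R \<kappa>")
    case True
    have "ith_smallest bl (improving_switches G \<sigma>) (idx (memory \<kappa> \<gamma>)) =
        (code (Domino \<kappa> \<gamma>), code (st.alt (Domino \<kappa> \<gamma>)))"
      using st.select_chain_0[OF rep] st.select_chain_Suc[OF rep] True \<kappa> by (cases "\<kappa> = 0") auto
    then have "rule_step G bl P (\<sigma>, memory \<kappa> \<gamma>) =
        (\<sigma>(code (Domino \<kappa> \<gamma>) := code (st.alt (Domino \<kappa> \<gamma>))), memory \<kappa> (Suc \<gamma>))"
      unfolding step memory_Suc by (simp add: apply_switch_def)
    then show ?thesis using st.chain_step[OF rep True] \<kappa> by (intro exI conjI) auto
  next
    case False
    then have q: "\<gamma> = R \<kappa>" using st.\<gamma>_le by simp
    let ?S = "{k. 1 \<le> k \<and> k \<le> b \<and> c k \<noteq> 0}"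
    have "?S \<noteq> {}"
    proof
      assume "?S = {}"
      then have "potential c = 0" unfolding potential_def by (auto simp: le_Suc_eq)
      then show False using potential by simp
    qed
    moreover have fS: "finite ?S" by (rule finite_subset[of _ "{..b}"]) auto
    moreover define k where "k = Max ?S"
    ultimately have k: "1 \<le> k" "k \<le> b" "c k \<noteq> 0" using Max_in[of ?S] by auto
    have top: "c m = 0" if "k < m" "m \<le> b" for m
    proof (rule ccontr)
      assume "c m \<noteq> 0"
      then have "m \<in> ?S" using that k by simp
      then have "m \<le> k" unfolding k_def using fS by (rule Max_ge[rotated])
      then show False using that by simp
    qed
    have "memory k 0 = nxt (memory \<kappa> \<gamma>)" using k q memory_R by (simp add: memory_def)
    then have "rule_step G bl P (\<sigma>, memory \<kappa> \<gamma>) =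
        (\<sigma>(code (Level k (c k = 1)) := code (st.alt (Level k (c k = 1)))), memory k 0)"
      unfolding step using st.select_core[OF rep q k top] q memory_R by (simp add: apply_switch_def)
    then show ?thesis using st.core_step[OF rep q k top] k potential_step[of k c, OF k top]
      by (intro exI conjI) auto
  qed
qed

text \<open>Every state covered by the invariant has the same positive number of improving switches,
  so no such state is optimal; the invariant lasts for as many steps as the initial
  potential.\<close>

lemma long_run:
  assumes P: "\<And>h. P (nD + (6 * b + 2)) (num_p0_edges G) h = (idx h, nxt h)" and b: "1 \<le> b"
  shows "\<exists>\<sigma>0. admissible G \<sigma>0 \<and> (\<forall>t \<le> 2 ^ b. \<not> optimal G (fst (run G bl P \<sigma>0 t)))"
proof -
  interpret st0: counter_state b nD nF R c0 0 0 using initial_state by simp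
  define \<sigma>0 where "\<sigma>0 n = code (st0.sel (from_nat n))" for n
  have rep0: "st0.represents \<sigma>0" by (simp add: st0.represents_def \<sigma>0_def)
  have inv: "\<exists>c \<kappa> \<gamma> \<sigma>. run G bl P \<sigma>0 t = (\<sigma>, memory \<kappa> \<gamma>) \<and> counter_state b R c \<kappa> \<gamma> \<and>
    counter_state.represents b nD nF R c \<kappa> \<gamma> \<sigma> \<and> (\<kappa> = 0 \<longrightarrow> c = c0) \<and> potential c0 \<le> potential c + t" if "t \<le> potential c0" for t
    using that
  proof (induction t)
    case 0
    have "run G bl P \<sigma>0 0 = (\<sigma>0, memory 0 0)" by (simp add: run_def memory_def)
    then show ?case using rep0 initial_state[of 0] by (intro exI conjI) auto
  next
    case (Suc t)
    then obtain c \<kappa> \<gamma> \<sigma> where *: "run G bl P \<sigma>0 t = (\<sigma>, memory \<kappa> \<gamma>)" "counter_state b R c \<kappa> \<gamma>"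
      "counter_state.represents b nD nF R c \<kappa> \<gamma> \<sigma>" "\<kappa> = 0 \<Longrightarrow> c = c0" "potential c0 \<le> potential c + t" by auto
    have "0 < potential c" using * Suc.prems by linarith
    from run_step[where P = P and \<sigma> = \<sigma>, OF P *(2,3,4) this] obtain c' \<kappa>' \<gamma>' \<sigma>' where
      "rule_step G bl P (\<sigma>, memory \<kappa> \<gamma>) = (\<sigma>', memory \<kappa>' \<gamma>')" "counter_state b R c' \<kappa>' \<gamma>'"
      "counter_state.represents b nD nF R c' \<kappa>' \<gamma>' \<sigma>'" "\<kappa>' = 0 \<longrightarrow> c' = c0" "potential c \<le> Suc (potential c')"
      by blast
    moreover from this * have "run G bl P \<sigma>0 (Suc t) = (\<sigma>', memory \<kappa>' \<gamma>')" by (simp add: run_def)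
    ultimately show ?case using *(5) by (intro exI conjI) auto
  qed
  \<comment> \<open>The summand of level 1 alone is large enough, given that \<open>b\<close> is
    positive.\<close>
  have "(2::nat) ^ b \<le> 2 * (2 ^ (Suc b - 1) - 1)" using b by (cases b) auto
  also have "\<dots> \<le> potential c0" unfolding potential_def by (rule member_le_sum[of 1]) auto
  finally have le: "2 ^ b \<le> potential c0" .
  have "\<not> optimal G (fst (run G bl P \<sigma>0 t))" if t: "t \<le> 2 ^ b" for t
  proof -
    obtain c \<kappa> \<gamma> \<sigma> where *: "run G bl P \<sigma>0 t = (\<sigma>, memory \<kappa> \<gamma>)" "counter_state b R c \<kappa> \<gamma>"
      "counter_state.represents b nD nF R c \<kappa> \<gamma> \<sigma>" using inv[OF order_trans[OF t le]] by blast
    interpret st: counter_state b nD nF R c \<kappa> \<gamma> using *(2) .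
    have "card {v. st.improvable v} \<noteq> 0" unfolding st.card_improvable by simp
    then have "{v. st.improvable v} \<noteq> {}" by (metis card.empty)
    then show ?thesis using st.improving_switches_eq[OF *(3)] *(1) by (simp add: optimal_def)
  qed
  then show ?thesis using admissibleI[OF st0.represents_strategy0[OF rep0]] by blast
qed

end

section \<open>The number of player 0 edges\<close>

context counter
begin

lemma card_inner_edges_le:
  "card (Sigma inner succs) \<le> 2 * (8 * b + 2 + sum R {..b} + nD)"
proof -
  have fin: "finite inner" by (auto simp: inner_def)
  have le2: "card (succs v) \<le> 2" "finite (succs v)" for v
    by (cases v rule: succs.cases; simp add: card_insert_if)+
  have un: "card (A1 \<union> A2 \<union> A3 \<union> A4 \<union> A5) \<le> card A1 + card A2 + card A3 + card A4 + card A5"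
    for A1 A2 A3 A4 A5 :: "node set"
    by (rule order_trans[OF card_Un_le add_right_mono], rule order_trans[OF card_Un_le add_right_mono],
        rule order_trans[OF card_Un_le add_right_mono], rule card_Un_le)
  have c1: "card ((\<lambda>(k, j). Level k j) ` ({1..b} \<times> (UNIV :: bool set))) \<le> 2 * b"
    using card_image_le[of "{1..b} \<times> (UNIV :: bool set)" "\<lambda>(k, j). Level k j"] by simp
  have c3: "card ((\<lambda>(k, j, i). Watch k j i) ` ({1..b} \<times> (UNIV :: bool set) \<times> (UNIV :: bool set))) \<le> 4 * b"
    using card_image_le[of "{1..b} \<times> (UNIV :: bool set) \<times> (UNIV :: bool set)" "\<lambda>(k, j, i). Watch k j i"]
    by (simp del: UNIV_Times_UNIV)
  have c4: "card ((\<lambda>(k, j). Tail k j) ` ({..b} \<times> (UNIV :: bool set))) \<le> 2 * (b + 1)"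
    using card_image_le[of "{..b} \<times> (UNIV :: bool set)" "\<lambda>(k, j). Tail k j"] by simp
  have c5: "card (Dummy ` {..<nD}) \<le> nD" using card_image_le[of "{..<nD}" Dummy] by simp
  have c2: "card (\<Union>k\<le>b. Domino k ` {..<R k}) \<le> sum R {..b}"
  proof -
    have "card (\<Union>k\<le>b. Domino k ` {..<R k}) \<le> (\<Sum>k\<le>b. card (Domino k ` {..<R k}))"
      by (rule card_UN_le) simp
    also have "\<dots> \<le> sum R {..b}" by (intro sum_mono card_image_le[THEN order_trans]) auto
    finally show ?thesis .
  qed
  note c = un[of "(\<lambda>(k, j). Level k j) ` ({1..b} \<times> UNIV)" "\<Union>k\<le>b. Domino k ` {..<R k}"
    "(\<lambda>(k, j, i). Watch k j i) ` ({1..b} \<times> UNIV \<times> UNIV)" "(\<lambda>(k, j). Tail k j) ` ({..b} \<times> UNIV)"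
    "Dummy ` {..<nD}", folded inner_def]
  have "card inner \<le> 2 * b + sum R {..b} + 4 * b + 2 * (b + 1) + nD"
    by (rule order_trans[OF c], intro add_mono c1 c2 c3 c4 c5)
  moreover have "card (Sigma inner succs) \<le> 2 * card inner"
    using sum_bounded_above[of inner "\<lambda>v. card (succs v)" 2] fin le2 by (simp add: card_SigmaI)
  ultimately show ?thesis by (simp add: algebra_simps)
qed

lemma num_p0_edges_eq: "num_p0_edges G = nF + card (Sigma inner succs)"
proof -
  let ?F = "(\<lambda>d. (Filler d, Sink)) ` {..<nF}"
  have own: "own0 v \<longleftrightarrow> v \<in> inner \<or> (\<exists>d<nF. v = Filler d)" for v
  proof -
    have "own0 v \<longleftrightarrow> v \<in> inner \<union> Filler ` {..<nF}" using own0_eq by blast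
    then show ?thesis by (auto simp: image_iff Bex_def)
  qed
  have "p0_edges G = map_prod code code ` (?F \<union> Sigma inner succs)"
    unfolding p0_edges_eq own by force
  then have "card (p0_edges G) = card (?F \<union> Sigma inner succs)"
    by (simp add: card_image[OF inj_on_subset[OF prod.inj_map[OF inj_to_nat inj_to_nat] subset_UNIV]])
  also have "\<dots> = card ?F + card (Sigma inner succs)"
  proof (rule card_Un_disjoint)
    have "finite (succs v)" for v by (cases v rule: succs.cases) auto
    then show "finite (Sigma inner succs)" by (intro finite_SigmaI) (auto simp: inner_def)
  qed (auto simp: inner_def)
  also have "card ?F = nF" by (simp add: card_image inj_on_def)
  finally show ?thesis by (simp add: num_p0_edges_def)
qed

end

section \<open>Gaps, mirroring and the superpolynomial bound\<close>

text \<open>Otherwise the blocks of length \<open>n\<close> starting in \<open>S\<close> would cover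
  all of \<open>{Min S..p}\<close>. At most \<open>L\<close> blocks cover at most
  \<open>L * n\<close> numbers, but \<open>Min S < n\<close> leaves more than that.\<close>

lemma ex_gap:
  fixes S :: "nat set"
  assumes S: "S \<subseteq> {1..p}" "S \<noteq> {}" "card S \<le> L" and p: "(L + 1) * n \<le> p" and m: "Min S < n"
  shows "\<exists>s \<in> S. s + n \<le> p + 1 \<and> (\<forall>x \<in> S. x \<le> s \<or> s + n \<le> x)"
proof (rule ccontr)
  assume no: "\<not> ?thesis"
  have fin: "finite S" using S finite_subset by blast
  have "{Min S..p} \<subseteq> (\<Union>s\<in>S. {s..<s + n})"
  proof
    fix y assume y: "y \<in> {Min S..p}"
    let ?T = "{x \<in> S. x \<le> y}"
    define t where "t = Max ?T"
    have "Min S \<in> ?T" using y Min_in[OF fin S(2)] by simp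
    then have "t \<in> ?T" unfolding t_def by (intro Max_in) (use fin in auto)
    then have t: "t \<in> S" "t \<le> y" by auto
    have tm: "x \<le> t" if "x \<in> S" "x \<le> y" for x
      unfolding t_def by (rule Max_ge) (use fin that in auto)
    have "y < t + n"
    proof (rule ccontr)
      assume "\<not> y < t + n"
      then have "t + n \<le> p + 1" "\<forall>x \<in> S. x \<le> t \<or> t + n \<le> x" using tm y by (auto simp: not_le)
      then show False using no t by blast
    qed
    then show "y \<in> (\<Union>s\<in>S. {s..<s + n})" using t by auto
  qed
  then have "card {Min S..p} \<le> card (\<Union>s\<in>S. {s..<s + n})" using fin by (intro card_mono) auto
  also have "\<dots> \<le> (\<Sum>s\<in>S. card {s..<s + n})" by (rule card_UN_le[OF fin])
  also have "\<dots> = card S * n" by simp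
  also have "\<dots> \<le> L * n" using S by (intro mult_right_mono) auto
  finally show False using p m by (simp add: algebra_simps)
qed

text \<open>Pigeonhole for the memory states at the \<open>L + 1\<close> times
  \<open>0..L\<close>.\<close>

lemma ex_cycle:
  fixes nxt :: "nat \<Rightarrow> nat"
  assumes "\<And>h. nxt h \<in> {1..L}" "1 \<le> L"
  shows "\<exists>a d. 1 \<le> d \<and> a + d \<le> L \<and> (\<forall>t \<ge> a. (nxt ^^ (t + d)) 1 = (nxt ^^ t) 1)"
proof -
  let ?o = "\<lambda>t. (nxt ^^ t) 1"
  have "?o t \<in> {1..L}" for t using assms by (cases t) auto
  then have "?o ` {0..L} \<subseteq> {1..L}" by blast
  then have "card (?o ` {0..L}) \<le> L" using card_mono[of "{1..L}" "?o ` {0..L}"] by simp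
  then have "\<not> inj_on ?o {0..L}" using card_image[of ?o "{0..L}"] by auto
  then obtain u v where "u \<le> L" "v \<le> L" "u \<noteq> v" "?o u = ?o v" by (auto simp: inj_on_def)
  then obtain a a' where a: "a < a'" "a' \<le> L" "?o a = ?o a'" by (metis linorder_neqE_nat)
  have "?o (t + (a' - a)) = ?o t" if "a \<le> t" for t
  proof -
    have "t + (a' - a) = (t - a) + a'" "t = (t - a) + a" using that a by auto
    then show ?thesis using a(3) by (metis funpow_add comp_apply)
  qed
  then show ?thesis using a by (intro exI[of _ a] exI[of _ "a' - a"]) auto
qed

text \<open>The rule enters only through its outputs at \<open>m\<close> and at the constant number
  of improving switches, so the result applies to a given rule as well as to its reflection.\<close>

lemma ex_game_gap:
  fixes idx nxt :: "nat \<Rightarrow> nat"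
  assumes idx: "\<And>h. idx h \<in> {1..(L + 1) * (6 * b + 2)}"
    and d: "1 \<le> d" "a + d \<le> L" and per: "\<And>t. a \<le> t \<Longrightarrow> (nxt ^^ (t + d)) 1 = (nxt ^^ t) 1"
    and t0: "a \<le> t0" "t0 < a + d"
    and s: "s = idx ((nxt ^^ t0) 1)" "s + (6 * b + 2) \<le> (L + 1) * (6 * b + 2) + 1"
    and gap: "\<And>t. a \<le> t \<Longrightarrow> idx ((nxt ^^ t) 1) \<le> s \<or> s + (6 * b + 2) \<le> idx ((nxt ^^ t) 1)"
    and b: "1 \<le> b" and m: "32 * L * (b + 1) \<le> m"
  shows "\<exists>G bl. sink_parity_game G \<and> num_p0_edges G = m \<and> bland_numbering G bl \<and>
    (\<forall>P. (\<forall>h. P ((L + 1) * (6 * b + 2)) m h = (idx h, nxt h)) \<longrightarrow>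
      (\<exists>\<sigma>0. admissible G \<sigma>0 \<and> (\<forall>t \<le> 2 ^ b. \<not> optimal G (fst (run G bl P \<sigma>0 t)))))"
proof -
  \<comment> \<open>One more period at level 0, and two periods minus the level switch at the
    others, keep all chains nonempty even if \<open>t0 = 0\<close> or \<open>d = 1\<close>.\<close>
  define R where "R k = (if k = 0 then t0 + d else 2 * d - 1)" for k :: nat
  define nD where "nD = L * (6 * b + 2)"
  have p: "(L + 1) * (6 * b + 2) = nD + (6 * b + 2)" by (simp add: nD_def)
  interpret c': counter b nD 0 R by unfold_locales (use d in \<open>auto simp: R_def\<close>)
  \<comment> \<open>\<open>e\<close> does not depend on the number of fillers, so
    \<open>m - e\<close> fillers bring the number of edges to exactly \<open>m\<close>.\<close>
  define e where "e = card (Sigma (counter.inner b nD R) (counter.succs R))"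
  have "R k \<le> 2 * L" for k using d t0 by (auto simp: R_def)
  then have "sum R {..b} \<le> (b + 1) * (2 * L)"
    using sum_bounded_above[of "{..b}" R "2 * L"] by simp
  note sum_R = this
  have "e \<le> 2 * (8 * b + 2 + sum R {..b} + nD)" unfolding e_def by (rule c'.card_inner_edges_le)
  also have "\<dots> \<le> 2 * (8 * b + 2 + (b + 1) * (2 * L) + nD)"
    by (intro mult_le_mono2 add_le_mono1 add_left_mono sum_R)
  also have "\<dots> \<le> 32 * L * (b + 1)"
  proof -
    obtain L' where "L = Suc L'" using d by (cases L) auto
    then show ?thesis by (simp add: nD_def algebra_simps)
  qed
  finally have em: "e \<le> m" using m by simp
  have it: "(nxt ^^ i) ((nxt ^^ j) 1) = (nxt ^^ (i + j)) 1" for i j by (simp add: funpow_add)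
  interpret c: counter_rule b nD "m - e" R idx nxt "2 * d - 1" "(nxt ^^ t0) 1" s
  proof
    show "R (Suc k) = 2 * d - 1" for k by (simp add: R_def)
    show "(nxt ^^ R 0) 1 = (nxt ^^ t0) 1" using per[OF t0(1)] by (simp add: R_def)
    have "Suc (2 * d - 1) + t0 = (t0 + d) + d" using d by simp
    then show "(nxt ^^ Suc (2 * d - 1)) ((nxt ^^ t0) 1) = (nxt ^^ t0) 1"
      unfolding it using per[of t0] per[of "t0 + d"] t0 by (simp only: trans_le_add1)
    show "idx ((nxt ^^ t0) 1) = s" "1 \<le> s" "s \<le> nD + 1" using s idx[of "(nxt ^^ t0) 1"] p by auto
    show "1 \<le> idx ((nxt ^^ g) 1) \<and> idx ((nxt ^^ g) 1) \<le> nD + (6 * b + 2)" for g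
      using idx p by (metis atLeastAtMost_iff)
    show "1 \<le> idx ((nxt ^^ Suc g) ((nxt ^^ t0) 1)) \<and> idx ((nxt ^^ Suc g) ((nxt ^^ t0) 1)) \<le> nD + (6 * b + 2)
      \<and> (idx ((nxt ^^ Suc g) ((nxt ^^ t0) 1)) \<le> s \<or> s + (6 * b + 2) \<le> idx ((nxt ^^ Suc g) ((nxt ^^ t0) 1)))" for g
      unfolding it using idx[of "(nxt ^^ (Suc g + t0)) 1"] gap[of "Suc g + t0"] t0 p by simp
  qed
  have m: "num_p0_edges c.G = m" using c.num_p0_edges_eq em e_def by simp
  show ?thesis
    using c.game m c.bland c.long_run[OF _ b] unfolding p by (intro exI[of _ c.G] exI[of _ c.bl]) auto
qed

text \<open>Index \<open>i\<close> under the reversed Bland numbers picks the same switch as index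
  \<open>p + 1 - i\<close> under the original ones, so a game built for the reflected rule also
  serves the rule itself.\<close>

lemma run_mirror:
  fixes bl :: "nat \<times> nat \<Rightarrow> nat"
  assumes fin: "finite (p0_edges G)" and bl: "bland_numbering G bl"
    and P: "\<And>p m h. 1 \<le> p \<Longrightarrow> fst (P p m h) \<in> {1..p}"
  defines "bl' \<equiv> \<lambda>e. Suc (sum bl (p0_edges G)) - bl e"
    and "P' \<equiv> \<lambda>p m h. (p + 1 - fst (P p m h), snd (P p m h))"
  shows "bland_numbering G bl'" and "run G bl' P \<sigma>0 t = run G bl P' \<sigma>0 t"
proof -
  let ?B = "Suc (sum bl (p0_edges G))"
  have B: "bl e < ?B" if "e \<in> p0_edges G" for e
    using member_le_sum[OF that, of bl] fin by (simp add: less_Suc_eq_le)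
  have inj: "inj_on bl (p0_edges G)" using bl by (simp add: bland_numbering_def)
  show "bland_numbering G bl'" unfolding bland_numbering_def
  proof
    show "inj_on bl' (p0_edges G)"
    proof (rule inj_onI)
      fix x y assume xy: "x \<in> p0_edges G" "y \<in> p0_edges G" "bl' x = bl' y"
      then have "bl x = bl y" using B[of x] B[of y] unfolding bl'_def by linarith
      then show "x = y" using inj_onD[OF inj] xy by blast
    qed
    show "\<forall>e\<in>p0_edges G. 0 < bl' e" using B by (auto simp: bl'_def)
  qed
  have "rule_step G bl' P st = rule_step G bl P' st" for st
  proof (cases "improving_switches G (fst st) = {}")
    case True
    then show ?thesis by (simp add: rule_step_def)
  next
    case False
    let ?I = "improving_switches G (fst st)"
    have I: "?I \<subseteq> p0_edges G" by (auto simp: improving_switches_def improving_def)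
    then have fI: "finite ?I" using fin finite_subset by blast
    let ?i = "fst (P (card ?I) (num_p0_edges G) (snd st))"
    have "1 \<le> card ?I" using False fI by (simp add: Suc_le_eq card_gt_0_iff)
    then have i: "1 \<le> ?i" "?i \<le> card ?I" using P[of "card ?I"] by auto
    have "ith_smallest bl' ?I (card ?I + 1 - (card ?I + 1 - ?i)) = ith_smallest bl ?I (card ?I + 1 - ?i)"
      unfolding bl'_def by (rule ith_smallest_mirror[OF fI inj_on_subset[OF inj I]]) (use I B i in auto)
    moreover have "card ?I + 1 - (card ?I + 1 - ?i) = ?i" using i by simp
    ultimately show ?thesis using False by (simp add: rule_step_def P'_def Let_def)
  qed
  then have "rule_step G bl' P = rule_step G bl P'" by blast
  then show "run G bl' P \<sigma>0 t = run G bl P' \<sigma>0 t" by (simp add: run_def)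
qed

lemma ex_game_long:
  assumes P: "index_selector l P" and b: "1 \<le> b" and m: "32 * l m * (b + 1) \<le> m"
  shows "\<exists>G bl \<sigma>0. sink_parity_game G \<and> num_p0_edges G = m \<and> bland_numbering G bl \<and> admissible G \<sigma>0 \<and>
    (\<forall>t \<le> 2 ^ b. \<not> optimal G (fst (run G bl P \<sigma>0 t)))"
proof -
  define n where "n = 6 * b + 2"
  define L where "L = l m"
  define p where "p = (L + 1) * n"
  have p1: "1 \<le> p" by (simp add: p_def n_def)
  define idx where "idx h = fst (P p m h)" for h
  define nxt where "nxt h = snd (P p m h)" for h
  have "P p m h \<in> {1..p} \<times> {1..L}" for h using P p1 unfolding index_selector_def L_def by blast
  then have idx: "idx h \<in> {1..p}" and nxt: "nxt h \<in> {1..L}" for h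
    unfolding idx_def nxt_def mem_Times_iff by blast+
  have "1 \<le> L" using nxt[of 0] by auto
  from ex_cycle[of nxt L, OF nxt this] obtain a d where d: "1 \<le> d" "a + d \<le> L"
    and per: "\<And>t. a \<le> t \<Longrightarrow> (nxt ^^ (t + d)) 1 = (nxt ^^ t) 1" by blast
  define S where "S = (\<lambda>t. idx ((nxt ^^ t) 1)) ` {a..<a + d}"
  have inS: "idx ((nxt ^^ t) 1) \<in> S" if "a \<le> t" for t
    using that
  proof (induction t rule: less_induct)
    case (less t)
    show ?case
    proof (cases "t < a + d")
      case True
      then show ?thesis using less by (auto simp: S_def)
    next
      case False
      then have "idx ((nxt ^^ (t - d)) 1) \<in> S" using less d by simp
      then show ?thesis using per[of "t - d"] False by simp
    qed
  qed
  have S: "S \<subseteq> {1..p}" "S \<noteq> {}" "card S \<le> L"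
    using idx d card_image_le[of "{a..<a + d}" "\<lambda>t. idx ((nxt ^^ t) 1)"] by (auto simp: S_def)
  show ?thesis
  proof (cases "Min S < n")
    case True
    then obtain s where s: "s \<in> S" "s + n \<le> p + 1" "\<forall>x \<in> S. x \<le> s \<or> s + n \<le> x"
      using ex_gap[OF S _ True] p_def by blast
    then obtain t0 where t0: "a \<le> t0" "t0 < a + d" "s = idx ((nxt ^^ t0) 1)" by (auto simp: S_def)
    have "\<exists>G bl. sink_parity_game G \<and> num_p0_edges G = m \<and> bland_numbering G bl \<and>
      (\<forall>P. (\<forall>h. P ((L + 1) * (6 * b + 2)) m h = (idx h, nxt h)) \<longrightarrow>
        (\<exists>\<sigma>0. admissible G \<sigma>0 \<and> (\<forall>t \<le> 2 ^ b. \<not> optimal G (fst (run G bl P \<sigma>0 t)))))"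
    proof (rule ex_game_gap[where a = a and d = d and s = s and ?t0.0 = t0])
      show "idx h \<in> {1..(L + 1) * (6 * b + 2)}" for h using idx by (simp only: p_def n_def)
      show "s + (6 * b + 2) \<le> (L + 1) * (6 * b + 2) + 1" using s(2) by (simp only: p_def n_def)
      show "idx ((nxt ^^ t) 1) \<le> s \<or> s + (6 * b + 2) \<le> idx ((nxt ^^ t) 1)" if "a \<le> t" for t
        using s(3) inS[OF that] by (simp only: n_def)
    qed (use d per t0 b m L_def in auto)
    then obtain G bl where G: "sink_parity_game G" "num_p0_edges G = m" "bland_numbering G bl"
      and r: "\<And>P'. (\<forall>h. P' p m h = (idx h, nxt h)) \<Longrightarrow>
        \<exists>\<sigma>0. admissible G \<sigma>0 \<and> (\<forall>t \<le> 2 ^ b. \<not> optimal G (fst (run G bl P' \<sigma>0 t)))"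
      unfolding p_def n_def by blast
    have "\<forall>h. P p m h = (idx h, nxt h)" by (simp add: idx_def nxt_def)
    from r[of P, OF this] show ?thesis using G by blast
  next
    case False
    \<comment> \<open>All indices in the period are at least \<open>n\<close> here. After
      reflection, the image of the smallest one is the largest and has \<open>n - 1\<close> free
      indices above it.\<close>
    define idx' where "idx' h = p + 1 - idx h" for h
    have fS: "finite S" using S finite_subset by blast
    obtain t0 where t0: "a \<le> t0" "t0 < a + d" "Min S = idx ((nxt ^^ t0) 1)"
      using Min_in[OF fS S(2)] by (auto simp: S_def)
    have Min: "Min S \<le> idx ((nxt ^^ t) 1)" if "a \<le> t" for t using inS[OF that] fS by simp
    have "\<exists>G bl. sink_parity_game G \<and> num_p0_edges G = m \<and> bland_numbering G bl \<and>
      (\<forall>P. (\<forall>h. P ((L + 1) * (6 * b + 2)) m h = (idx' h, nxt h)) \<longrightarrow>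
        (\<exists>\<sigma>0. admissible G \<sigma>0 \<and> (\<forall>t \<le> 2 ^ b. \<not> optimal G (fst (run G bl P \<sigma>0 t)))))"
    proof (rule ex_game_gap[where a = a and d = d and s = "p + 1 - Min S" and ?t0.0 = t0])
      show "idx' h \<in> {1..(L + 1) * (6 * b + 2)}" for h
        using idx[of h] unfolding idx'_def p_def[unfolded n_def, symmetric] by auto
      show "p + 1 - Min S = idx' ((nxt ^^ t0) 1)" by (simp add: idx'_def t0)
      have "p + 1 - Min S + n \<le> p + 1" using False Min[OF t0(1)] idx[of "(nxt ^^ t0) 1"] by simp
      then show "p + 1 - Min S + (6 * b + 2) \<le> (L + 1) * (6 * b + 2) + 1" by (simp only: p_def n_def)
      show "idx' ((nxt ^^ t) 1) \<le> p + 1 - Min S \<or> p + 1 - Min S + (6 * b + 2) \<le> idx' ((nxt ^^ t) 1)"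
        if "a \<le> t" for t using Min[OF that] by (auto simp: idx'_def)
    qed (use d per t0 b m L_def in auto)
    then obtain G bl where G: "sink_parity_game G" "num_p0_edges G = m" "bland_numbering G bl"
      and r: "\<And>P. (\<forall>h. P p m h = (idx' h, nxt h)) \<Longrightarrow>
        \<exists>\<sigma>0. admissible G \<sigma>0 \<and> (\<forall>t \<le> 2 ^ b. \<not> optimal G (fst (run G bl P \<sigma>0 t)))"
      unfolding p_def n_def by blast
    let ?P = "\<lambda>p m h. (p + 1 - fst (P p m h), snd (P p m h))"
    obtain \<sigma>0 where \<sigma>0: "admissible G \<sigma>0" "\<forall>t \<le> 2 ^ b. \<not> optimal G (fst (run G bl ?P \<sigma>0 t))"
      using r[of ?P] by (auto simp: idx'_def idx_def nxt_def)
    have "finite (V0 G)" "E G \<subseteq> VG G \<times> VG G" "finite (VG G)"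
      using G(1) by (auto simp: sink_parity_game_def VG_def)
    then have fin: "finite (p0_edges G)"
      by (intro finite_subset[of "p0_edges G" "VG G \<times> VG G"]) (auto simp: p0_edges_def)
    have sel: "fst (P p m h) \<in> {1..p}" if "1 \<le> p" for p m h
    proof -
      have "P p m h \<in> {1..p} \<times> {1..l m}" using P that unfolding index_selector_def by blast
      then show ?thesis by (simp only: mem_Times_iff)
    qed
    let ?bl = "\<lambda>e. Suc (sum bl (p0_edges G)) - bl e"
    have "bland_numbering G ?bl" by (rule run_mirror(1)[OF fin G(3), of P]) (rule sel)
    moreover have "run G ?bl P \<sigma>0 t = run G bl ?P \<sigma>0 t" for t
      by (rule run_mirror(2)[OF fin G(3)]) (rule sel)
    ultimately show ?thesis using G \<sigma>0
      by (intro exI[of _ G] exI[of _ ?bl] exI[of _ \<sigma>0]) simp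
  qed
qed

text \<open>A star around the sink, for those \<open>m\<close> that leave no room for a
  counter.\<close>

lemma ex_game_trivial:
  "\<exists>G bl \<sigma>0. sink_parity_game G \<and> num_p0_edges G = m \<and> bland_numbering G bl \<and> admissible G \<sigma>0"
proof -
  define G where "G = \<lparr>V0 = {1..m}, V1 = {}, sink = 0, E = (\<lambda>v. (v, 0)) ` {0..m}, pri = \<lambda>_. 0\<rparr>"
  interpret sink_dag G id
  proof
    show "E G \<subseteq> VG G \<times> VG G" by (auto simp: G_def VG_def)
  qed (auto simp: G_def VG_def image_iff)
  have e: "p0_edges G = (\<lambda>v. (v, 0)) ` {1..m}" by (auto simp: p0_edges_def G_def)
  have "num_p0_edges G = m" unfolding num_p0_edges_def e by (simp add: card_image inj_on_def)
  moreover have "bland_numbering G fst" unfolding bland_numbering_def e by (auto simp: inj_on_def)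
  moreover have "admissible G (\<lambda>_. 0)" by (rule admissibleI) (auto simp: strategy0_def G_def)
  ultimately show ?thesis using game by blast
qed

section \<open>Asymptotics and the final bound\<close>

lemma eventually_powr_le:
  fixes l :: "nat \<Rightarrow> nat" and c :: real
  assumes l: "(\<lambda>m. real (l m)) \<in> o(\<lambda>m. real m / ln (real m))" and pos: "\<And>m. 1 \<le> l m"
  shows "\<forall>\<^sub>F m in sequentially. 1 \<le> m div (32 * l m) - 1 \<and> real m powr c \<le> 2 ^ (m div (32 * l m) - 1)"
proof -
  \<comment> \<open>The part \<open>2 * \<bar>c\<bar>\<close> survives the estimate
    \<open>1 / 2 \<le> ln 2\<close>; the part 4 absorbs the rounding and the subtraction of 1, as
    \<open>ln m > 1\<close>.\<close>
  define C where "C = 2 * \<bar>c\<bar> + 4"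
  have C: "0 < 1 / (32 * C)" by (simp add: C_def)
  have ln: "filterlim (\<lambda>m. ln (real m)) at_top sequentially"
    by (rule filterlim_compose[OF ln_at_top filterlim_real_sequentially])
  show ?thesis
    using landau_o.smallD[OF l C] filterlim_at_top_dense[THEN iffD1, rule_format, OF ln, of 1] eventually_gt_at_top[of 1]
  proof eventually_elim
    case (elim m)
    let ?b = "m div (32 * l m) - 1"
    have lm: "0 < real (l m)" using pos[of m] by simp
    have "0 < 32 * C * ln (real m)" using elim C by (simp add: zero_less_mult_iff)
    moreover have "real (l m) \<le> real m / (32 * C * ln (real m))" using elim by simp
    ultimately have "real (l m) * (32 * C * ln (real m)) \<le> real m"
      by (simp only: pos_le_divide_eq)
    then have "C * ln (real m) \<le> real m / real (32 * l m)" using lm by (simp add: field_simps)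
    also have "\<dots> < real (m div (32 * l m)) + 1" 
      using floor_correct[of "real m / real (32 * l m)"] unfolding floor_divide_of_nat_eq by simp
    finally have q: "C * ln (real m) < real (m div (32 * l m)) + 1" .
    have "C * 1 \<le> C * ln (real m)" using elim by (intro mult_left_mono) (auto simp: C_def)
    moreover have C2: "C * ln (real m) = 2 * (\<bar>c\<bar> * ln (real m)) + 4 * ln (real m)"
      by (simp add: C_def algebra_simps)
    ultimately have q2: "2 < m div (32 * l m)" using q by (auto simp: C_def)
    then have "2 * (\<bar>c\<bar> * ln (real m)) \<le> real ?b" using q C2 elim by (simp add: of_nat_diff)
    moreover have "real ?b * (1 / 2) \<le> real ?b * ln 2" using ln_one_minus_pos_upper_bound[of "1 / 2"]
      by (intro mult_left_mono) (simp_all add: ln_div)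
    moreover have "c * ln (real m) \<le> \<bar>c\<bar> * ln (real m)" using elim by (intro mult_right_mono) auto
    ultimately have "c * ln (real m) \<le> real ?b * ln 2" by linarith
    then have "exp (c * ln (real m)) \<le> exp (real ?b * ln 2)" by simp
    also have "exp (real ?b * ln 2) = 2 ^ ?b" by (subst exp_of_nat_mult) simp
    finally show ?case using q2 elim by (auto simp: powr_def)
  qed
qed

theorem theorem14:
  fixes l :: "nat \<Rightarrow> nat"
  assumes "(\<lambda>m. real (l m)) \<in> o(\<lambda>m. real m / ln (real m))"
  shows "\<forall>P. index_selector l P \<longrightarrow>
    (\<exists>G bl \<sigma>0. (\<forall>m. sink_parity_game (G m) \<and> num_p0_edges (G m) = m \<and>
                     bland_numbering (G m) (bl m) \<and> admissible (G m) (\<sigma>0 m)) \<and>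
       (\<forall>c::real. \<forall>\<^sub>F m in sequentially. \<forall>k::nat. real k < real m powr c \<longrightarrow>
            \<not> optimal (G m) (fst (run (G m) (bl m) P (\<sigma>0 m) k))))"
proof (intro allI impI)
  fix P assume P: "index_selector l P"
  have pos: "1 \<le> l m" for m
  proof -
    have "P 1 m 0 \<in> {1..1} \<times> {1..l m}" using P unfolding index_selector_def by blast
    then show ?thesis by (metis atLeastAtMost_iff mem_Times_iff order_trans)
  qed
  \<comment> \<open>The largest number of levels with \<open>32 * l m * (?b m + 1) \<le> m\<close>,
    if there is room for at least one.\<close>
  let ?b = "\<lambda>m. m div (32 * l m) - 1"
  have "\<exists>G bl \<sigma>0. sink_parity_game G \<and> num_p0_edges G = m \<and> bland_numbering G bl \<and> admissible G \<sigma>0 \<and>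
    (1 \<le> ?b m \<longrightarrow> (\<forall>t \<le> 2 ^ ?b m. \<not> optimal G (fst (run G bl P \<sigma>0 t))))" for m
  proof (cases "1 \<le> ?b m")
    case True
    then have "32 * l m * (?b m + 1) \<le> m" by simp
    then show ?thesis using ex_game_long[OF P True] by blast
  next
    case False
    then show ?thesis using ex_game_trivial[of m] by blast
  qed
  then obtain G bl \<sigma>0 where G: "\<And>m. sink_parity_game (G m) \<and> num_p0_edges (G m) = m \<and>
      bland_numbering (G m) (bl m) \<and> admissible (G m) (\<sigma>0 m) \<and>
      (1 \<le> ?b m \<longrightarrow> (\<forall>t \<le> 2 ^ ?b m. \<not> optimal (G m) (fst (run (G m) (bl m) P (\<sigma>0 m) t))))"
    by metis
  show "\<exists>G bl \<sigma>0. (\<forall>m. sink_parity_game (G m) \<and> num_p0_edges (G m) = m \<and>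
                     bland_numbering (G m) (bl m) \<and> admissible (G m) (\<sigma>0 m)) \<and>
       (\<forall>c::real. \<forall>\<^sub>F m in sequentially. \<forall>k::nat. real k < real m powr c \<longrightarrow>
            \<not> optimal (G m) (fst (run (G m) (bl m) P (\<sigma>0 m) k)))"
  proof (intro exI conjI allI)
    fix c :: real
    show "\<forall>\<^sub>F m in sequentially. \<forall>k::nat. real k < real m powr c \<longrightarrow>
            \<not> optimal (G m) (fst (run (G m) (bl m) P (\<sigma>0 m) k))"
      using eventually_powr_le[OF assms pos, of c]
    proof eventually_elim
      case (elim m)
      have "k \<le> 2 ^ ?b m" if "real k < real m powr c" for k
      proof -
        have "real k \<le> 2 ^ ?b m" using elim that by linarith
        then have "real k \<le> real (2 ^ ?b m)" unfolding of_nat_power of_nat_numeral .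
        then show ?thesis unfolding of_nat_le_iff .
      qed
      then show ?case using G elim by blast
    qed
  qed (use G in blast)+
qed

end
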